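(* Let $R\subset S$ be a seminormal infra-integral FCP extension. Then $R\subset S$ is distributive if and only if $R\subset S$ is locally minimal.
   Context: All rings are commutative with unit. $[R,S]$ denotes the set of all $R$-subalgebras of $S$, ordered by inclusion; it is a lattice in which the infimum of $T,U$ is $T\cap U$ and the supremum is the compositum $TU$. The extension $R\subseteq S$ is called distributive if the lattice $[R,S]$ is distributive. It has FCP if every chain in $[R,S]$ is finite. An extension $R\subset S$ (with $R\neq S$) is minimal if $[R,S]=\{R,S\}$. For $P\in\mathrm{Spec}(R)$, $S_P$ denotes the localization of $S$ at $R\setminus P$; $\mathrm{Supp}(S/R)=\{P\in\mathrm{Spec}(R)\mid R_P\neq S_P\}$. The extension $R\subset S$ is locally minimal if $R_P\subset S_P$ is minimal for each $P\in\mathrm{Supp}(S/R)$. An extension $R\subseteq S$ is seminormal if, for $b\in S$, the relations $b^2\in R$ and $b^3\in R$ imply $b\in R$. An integral extension $R\subseteq S$ is infra-integral if for every $Q\in\mathrm{Spec}(S)$ with $P:=Q\cap R$, the residual extension $R_P/PR_P\to S_Q/QS_Q$ is an isomorphism. *)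

theory Defs
  imports "HOL-Algebra.Algebra"
begin

text \<open>
  A ring extension R \<open>\<subseteq>\<close> S is a commutative ring S (a HOL-Algebra structure)
  together with a subring R of S, given by its underlying set; as a ring in its own right
  it is the structure \<open>S\<lparr>carrier := R\<rparr>\<close>.
\<close>

subsection \<open>The lattice [R,S]\<close>

definition subalgebras :: "('a, 'b) ring_scheme \<Rightarrow> 'a set \<Rightarrow> 'a set set" where
  "subalgebras S R = {T. subring T S \<and> R \<subseteq> T}"

definition compositum :: "('a, 'b) ring_scheme \<Rightarrow> 'a set \<Rightarrow> 'a set \<Rightarrow> 'a set" where
  "compositum S T U = generate_ring S (T \<union> U)"

definition distributive_extension :: "('a, 'b) ring_scheme \<Rightarrow> 'a set \<Rightarrow> bool" where
  "distributive_extension S R \<longleftrightarrow>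
     (\<forall>T \<in> subalgebras S R. \<forall>U \<in> subalgebras S R. \<forall>V \<in> subalgebras S R.
        T \<inter> compositum S U V = compositum S (T \<inter> U) (T \<inter> V))"

definition FCP_extension :: "('a, 'b) ring_scheme \<Rightarrow> 'a set \<Rightarrow> bool" where
  "FCP_extension S R \<longleftrightarrow> (\<forall>\<C>. subset.chain (subalgebras S R) \<C> \<longrightarrow> finite \<C>)"

definition minimal_extension :: "('a, 'b) ring_scheme \<Rightarrow> 'a set \<Rightarrow> bool" where
  "minimal_extension S R \<longleftrightarrow> R \<noteq> carrier S \<and> subalgebras S R = {R, carrier S}"


subsection \<open>Localization\<close>

text \<open>
  The localization of a commutative ring A at a multiplicative subset M: its elements are
  classes of pairs (a, s), standing for a/s, where a/s = b/t iff u (a t) = u (b s) for some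
  u in M (the factor u is needed since A may have zero divisors).
\<close>

definition frac_rel :: "('a, 'b) ring_scheme \<Rightarrow> 'a set \<Rightarrow> (('a \<times> 'a) \<times> ('a \<times> 'a)) set" where
  "frac_rel A M =
     {((a, s), (b, t)) | a s b t.
        a \<in> carrier A \<and> s \<in> M \<and> b \<in> carrier A \<and> t \<in> M \<and>
        (\<exists>u \<in> M. u \<otimes>\<^bsub>A\<^esub> (a \<otimes>\<^bsub>A\<^esub> t) = u \<otimes>\<^bsub>A\<^esub> (b \<otimes>\<^bsub>A\<^esub> s))}"

definition fraction :: "('a, 'b) ring_scheme \<Rightarrow> 'a set \<Rightarrow> 'a \<Rightarrow> 'a \<Rightarrow> ('a \<times> 'a) set" where
  "fraction A M a s = frac_rel A M `` {(a, s)}"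

definition frac_add ::
  "('a, 'b) ring_scheme \<Rightarrow> 'a set \<Rightarrow> ('a \<times> 'a) set \<Rightarrow> ('a \<times> 'a) set \<Rightarrow> ('a \<times> 'a) set" where
  "frac_add A M x y =
     (\<Union>(a, s) \<in> x. \<Union>(b, t) \<in> y.
        fraction A M ((a \<otimes>\<^bsub>A\<^esub> t) \<oplus>\<^bsub>A\<^esub> (b \<otimes>\<^bsub>A\<^esub> s)) (s \<otimes>\<^bsub>A\<^esub> t))"

definition frac_mult ::
  "('a, 'b) ring_scheme \<Rightarrow> 'a set \<Rightarrow> ('a \<times> 'a) set \<Rightarrow> ('a \<times> 'a) set \<Rightarrow> ('a \<times> 'a) set" where
  "frac_mult A M x y =
     (\<Union>(a, s) \<in> x. \<Union>(b, t) \<in> y. fraction A M (a \<otimes>\<^bsub>A\<^esub> b) (s \<otimes>\<^bsub>A\<^esub> t))"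

definition localization :: "('a, 'b) ring_scheme \<Rightarrow> 'a set \<Rightarrow> ('a \<times> 'a) set ring" where
  "localization A M =
     \<lparr> carrier = (carrier A \<times> M) // frac_rel A M,
       monoid.mult = frac_mult A M,
       one = fraction A M \<one>\<^bsub>A\<^esub> \<one>\<^bsub>A\<^esub>,
       ring.zero = fraction A M \<zero>\<^bsub>A\<^esub> \<one>\<^bsub>A\<^esub>,
       add = frac_add A M \<rparr>"

text \<open>
  For a subring A of B and multiplicative subsets M \<open>\<subseteq>\<close> N of A and B, respectively,
  \<open>loc_map B N\<close> is the canonical map from the localization of A at M to that
  of B at N, sending the class of (a, s) to the class of (a, s).
\<close>

definition loc_map ::
  "('a, 'b) ring_scheme \<Rightarrow> 'a set \<Rightarrow> ('a \<times> 'a) set \<Rightarrow> ('a \<times> 'a) set" where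
  "loc_map B N x = frac_rel B N `` x"

text \<open>
  \<open>loc_ring S R P\<close> is the localization of S at R - P; \<open>loc_subring S R P\<close> is
  the localization of R at P, identified with its image under the (injective) canonical map.
\<close>

definition loc_ring :: "('a, 'b) ring_scheme \<Rightarrow> 'a set \<Rightarrow> 'a set \<Rightarrow> ('a \<times> 'a) set ring" where
  "loc_ring S R P = localization S (R - P)"

definition loc_subring :: "('a, 'b) ring_scheme \<Rightarrow> 'a set \<Rightarrow> 'a set \<Rightarrow> ('a \<times> 'a) set set" where
  "loc_subring S R P =
     loc_map S (R - P) ` carrier (localization (S\<lparr>carrier := R\<rparr>) (R - P))"

definition ring_spec :: "('a, 'b) ring_scheme \<Rightarrow> 'a set set" where
  "ring_spec A = {P. primeideal P A}"

definition ext_support :: "('a, 'b) ring_scheme \<Rightarrow> 'a set \<Rightarrow> 'a set set" where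
  "ext_support S R =
     {P \<in> ring_spec (S\<lparr>carrier := R\<rparr>). loc_subring S R P \<noteq> carrier (loc_ring S R P)}"

definition locally_minimal_extension :: "('a, 'b) ring_scheme \<Rightarrow> 'a set \<Rightarrow> bool" where
  "locally_minimal_extension S R \<longleftrightarrow>
     (\<forall>P \<in> ext_support S R. minimal_extension (loc_ring S R P) (loc_subring S R P))"


subsection \<open>Seminormal and infra-integral extensions\<close>

definition seminormal_extension :: "('a, 'b) ring_scheme \<Rightarrow> 'a set \<Rightarrow> bool" where
  "seminormal_extension S R \<longleftrightarrow>
     (\<forall>b \<in> carrier S. b [^]\<^bsub>S\<^esub> (2::nat) \<in> R \<longrightarrow> b [^]\<^bsub>S\<^esub> (3::nat) \<in> R \<longrightarrow> b \<in> R)"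

definition integral_extension :: "('a, 'b) ring_scheme \<Rightarrow> 'a set \<Rightarrow> bool" where
  "integral_extension S R \<longleftrightarrow>
     (\<forall>x \<in> carrier S. \<exists>p \<in> carrier (univ_poly S R).
        p \<noteq> [] \<and> lead_coeff p = \<one>\<^bsub>S\<^esub> \<and> ring.eval S p x = \<zero>\<^bsub>S\<^esub>)"

definition loc_max_ideal :: "('a, 'b) ring_scheme \<Rightarrow> 'a set \<Rightarrow> ('a \<times> 'a) set set" where
  "loc_max_ideal A P =
     genideal (localization A (carrier A - P)) ((\<lambda>a. fraction A (carrier A - P) a \<one>\<^bsub>A\<^esub>) ` P)"

definition residue_field :: "('a, 'b) ring_scheme \<Rightarrow> 'a set \<Rightarrow> ('a \<times> 'a) set set ring" where
  "residue_field A P = localization A (carrier A - P) Quot loc_max_ideal A P"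

text \<open>
  For a prime Q of S over a prime P of R, \<open>residual_map S Q\<close> is the map from the residue
  field of R at P to that of S at Q that is induced by the canonical map of the localizations:
  the coset of a/s goes to the coset of a/s. It maps a coset C (a set of fractions) to the union
  of the cosets of the images of its elements, all of which coincide.
\<close>

definition residual_map ::
  "('a, 'b) ring_scheme \<Rightarrow> 'a set \<Rightarrow> ('a \<times> 'a) set set \<Rightarrow> ('a \<times> 'a) set set" where
  "residual_map S Q C =
     (\<Union>x \<in> C. loc_max_ideal S Q +>\<^bsub>localization S (carrier S - Q)\<^esub>
                 loc_map S (carrier S - Q) x)"

definition infra_integral_extension :: "('a, 'b) ring_scheme \<Rightarrow> 'a set \<Rightarrow> bool" where
  "infra_integral_extension S R \<longleftrightarrow>
     integral_extension S R \<and>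
     (\<forall>Q \<in> ring_spec S.
        residual_map S Q \<in> ring_iso (residue_field (S\<lparr>carrier := R\<rparr>) (Q \<inter> R)) (residue_field S Q))"

end

theory Submission
  imports Defs
begin

text \<open>
  Fix a prime \<open>P\<close> of \<open>R\<close> in the support of the extension. Everything depends on the number of primes
  of \<open>S\<close> over \<open>P\<close>. The extension \<open>R\<^sub>P \<subseteq> S\<^sub>P\<close>, taken modulo its conductor, has the form \<open>k \<subseteq> k\<^sup>n\<close>, where
  \<open>k\<close> is the residue field of \<open>P\<close> and \<open>n\<close> is that number. The subalgebras of \<open>k\<^sup>n\<close> correspond to the
  partitions of an \<open>n\<close>-element set. For \<open>n \<le> 2\<close> there are only the two trivial ones, whereas given
  three points, the three partitions that identify just two of them violate distributivity. The proof
  below works with primes instead of the coordinates of \<open>k\<^sup>n\<close>, and it avoids computing in \<open>S\<^sub>P\<close>: a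
  subalgebra of \<open>S\<^sub>P\<close> is replaced by its preimage in \<open>S\<close>, which is a subalgebra \<open>T\<close> that is
  saturated, in the sense that \<open>u x \<in> T\<close> with \<open>u \<in> R - P\<close> implies \<open>x \<in> T\<close>.

  Distributive implies locally minimal. Infra-integrality says that modulo any prime \<open>Q\<close> over \<open>P\<close>,
  every element of \<open>S\<close> is a fraction of elements of \<open>R\<close> (\<open>residue_fraction\<close>). Given three primes
  \<open>Q\<^sub>1\<close>, \<open>Q\<^sub>2\<close>, \<open>Q\<^sub>3\<close> over \<open>P\<close>, the subalgebras of the elements that take the same value at \<open>Q\<^sub>i\<close> and
  \<open>Q\<^sub>j\<close> contradict distributivity (\<open>three_primes_not_distributive\<close>). Hence at most two primes lie
  over \<open>P\<close>.

  It remains to see that these primes determine \<open>S\<^sub>P\<close> up to elements of \<open>R\<^sub>P\<close>. For \<open>a \<in> P\<close> and a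
  finite subalgebra \<open>Y\<close> of \<open>S\<close>, the chain \<open>R + a\<^sup>n Y\<close> becomes stationary by FCP, Nakayama's lemma turns
  this into \<open>a\<^sup>n Y \<subseteq> R\<^sub>P\<close>, and seminormality lowers \<open>n\<close> to 1. Since every element of \<open>S\<close> is integral,
  this gives \<open>P S\<^sub>P \<subseteq> R\<^sub>P\<close> (\<open>P_conducts\<close>). Consequently \<open>P R\<^sub>P\<close> is an ideal of \<open>S\<^sub>P\<close>, and it is radical
  by seminormality, so that its preimage in \<open>S\<close> is the intersection of the primes over \<open>P\<close>. With at
  most two of these, a saturated subalgebra that contains an element outside \<open>R\<^sub>P\<close> has to be all of
  \<open>S\<close> (\<open>two_primes_simple\<close>).

  Locally minimal implies distributive. An identity between subalgebras can be checked at each prime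
  \<open>P\<close> of \<open>R\<close>, because the denominators that move a given element into a given subalgebra form an
  ideal of \<open>R\<close>. At \<open>P\<close> each subalgebra becomes one of at most two members of a chain, and chains are
  distributive (\<open>locally_minimal_imp_distributive\<close>).
\<close>

section \<open>Localization of a commutative ring\<close>

locale multiplicative_subset = cring A for A (structure) +
  fixes M
  assumes M_carrier: "M \<subseteq> carrier A"
    and M_one: "\<one> \<in> M"
    and M_mult: "\<lbrakk>s \<in> M; t \<in> M\<rbrakk> \<Longrightarrow> s \<otimes> t \<in> M"
begin

abbreviation Loc where "Loc \<equiv> localization A M"

lemma M_closed [simp, intro]: "s \<in> M \<Longrightarrow> s \<in> carrier A"
  using M_carrier by blast

lemma frac_rel_iff:
  "((a, s), (b, t)) \<in> frac_rel A M \<longleftrightarrow>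
     a \<in> carrier A \<and> s \<in> M \<and> b \<in> carrier A \<and> t \<in> M \<and>
     (\<exists>u \<in> M. u \<otimes> (a \<otimes> t) = u \<otimes> (b \<otimes> s))"
  by (auto simp: frac_rel_def)

lemma equiv_frac_rel: "equiv (carrier A \<times> M) (frac_rel A M)"
proof (rule equivI)
  show "frac_rel A M \<subseteq> (carrier A \<times> M) \<times> carrier A \<times> M"
    by (auto simp: frac_rel_def)
  show "refl_on (carrier A \<times> M) (frac_rel A M)"
    using M_one by (auto simp: refl_on_def frac_rel_def)
  show "sym (frac_rel A M)"
    by (rule symI) (clarsimp simp: frac_rel_iff, metis)
  show "trans (frac_rel A M)"
  proof (rule transI, clarsimp simp: frac_rel_iff)
    fix a s b t c w u v
    assume A: "a \<in> carrier A" "s \<in> M" "b \<in> carrier A" "t \<in> M" "c \<in> carrier A" "w \<in> M"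
      and uv: "u \<in> M" "v \<in> M"
      and u: "u \<otimes> (a \<otimes> t) = u \<otimes> (b \<otimes> s)" and v: "v \<otimes> (b \<otimes> w) = v \<otimes> (c \<otimes> t)"
    have c: "s \<in> carrier A" "t \<in> carrier A" "w \<in> carrier A" "u \<in> carrier A" "v \<in> carrier A"
      using A uv by auto
    have "(u \<otimes> v \<otimes> t) \<otimes> (a \<otimes> w) = v \<otimes> w \<otimes> (u \<otimes> (a \<otimes> t))"
      using A(1,3,5) c by algebra
    also have "\<dots> = u \<otimes> s \<otimes> (v \<otimes> (b \<otimes> w))"
      unfolding u using A(1,3,5) c by algebra
    also have "\<dots> = (u \<otimes> v \<otimes> t) \<otimes> (c \<otimes> s)"
      unfolding v using A(1,3,5) c by algebra
    finally show "\<exists>x\<in>M. x \<otimes> (a \<otimes> w) = x \<otimes> (c \<otimes> s)"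
      using M_mult uv A by blast
  qed
qed

lemma fraction_mem_iff:
  "(b, t) \<in> fraction A M a s \<longleftrightarrow> ((a, s), (b, t)) \<in> frac_rel A M"
  by (simp add: fraction_def)

lemma fraction_eq_iff:
  assumes "a \<in> carrier A" "s \<in> M" "b \<in> carrier A" "t \<in> M"
  shows "fraction A M a s = fraction A M b t \<longleftrightarrow> (\<exists>u \<in> M. u \<otimes> (a \<otimes> t) = u \<otimes> (b \<otimes> s))"
  using eq_equiv_class_iff[OF equiv_frac_rel, of "(a, s)" "(b, t)"] assms
  by (simp add: fraction_def frac_rel_iff)

lemma fraction_eqI:
  assumes "a \<in> carrier A" "s \<in> M" "b \<in> carrier A" "t \<in> M" "a \<otimes> t = b \<otimes> s"
  shows "fraction A M a s = fraction A M b t"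
  using assms M_one by (auto simp: fraction_eq_iff)

lemma carrier_Loc: "carrier Loc = {fraction A M a s | a s. a \<in> carrier A \<and> s \<in> M}"
  by (auto simp: localization_def fraction_def quotient_def)

lemma fraction_closed [simp, intro]:
  "\<lbrakk>a \<in> carrier A; s \<in> M\<rbrakk> \<Longrightarrow> fraction A M a s \<in> carrier Loc"
  by (auto simp: carrier_Loc)

text \<open>
  Addition and multiplication of fractions are defined as unions over all representatives. This
  rule reduces their computation to independence of the representatives.
\<close>

lemma UN_UN_const:
  assumes "p \<in> x" "q \<in> y" "\<And>p' q'. \<lbrakk>p' \<in> x; q' \<in> y\<rbrakk> \<Longrightarrow> f p' q' = f p q"
  shows "(\<Union>p' \<in> x. \<Union>q' \<in> y. f p' q') = f p q"
  using assms by blast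

lemma fraction_self: "\<lbrakk>a \<in> carrier A; s \<in> M\<rbrakk> \<Longrightarrow> (a, s) \<in> fraction A M a s"
  using M_one by (auto simp: fraction_mem_iff frac_rel_iff)

lemma mult_fraction:
  assumes "a \<in> carrier A" "s \<in> M" "b \<in> carrier A" "t \<in> M"
  shows "fraction A M a s \<otimes>\<^bsub>Loc\<^esub> fraction A M b t = fraction A M (a \<otimes> b) (s \<otimes> t)"
proof -
  have "frac_mult A M (fraction A M a s) (fraction A M b t)
      = (\<lambda>(a, s) (b, t). fraction A M (a \<otimes> b) (s \<otimes> t)) (a, s) (b, t)"
    unfolding frac_mult_def case_prod_unfold
  proof (rule UN_UN_const, goal_cases)
    case (3 p q)
    obtain a' s' b' t' where pq: "p = (a', s')" "q = (b', t')" by fastforce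
    obtain u v where uv: "u \<in> M" "v \<in> M" "u \<otimes> (a \<otimes> s') = u \<otimes> (a' \<otimes> s)"
        "v \<otimes> (b \<otimes> t') = v \<otimes> (b' \<otimes> t)"
      and A: "a' \<in> carrier A" "s' \<in> M" "b' \<in> carrier A" "t' \<in> M"
      using 3 unfolding pq fraction_mem_iff frac_rel_iff by blast
    have c: "s \<in> carrier A" "t \<in> carrier A" "s' \<in> carrier A" "t' \<in> carrier A"
        "u \<in> carrier A" "v \<in> carrier A"
      using A assms uv by auto
    have "(u \<otimes> v) \<otimes> ((a' \<otimes> b') \<otimes> (s \<otimes> t)) = (u \<otimes> (a' \<otimes> s)) \<otimes> (v \<otimes> (b' \<otimes> t))"
      using A(1,3) assms(1,3) c by algebra
    also have "\<dots> = (u \<otimes> v) \<otimes> ((a \<otimes> b) \<otimes> (s' \<otimes> t'))"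
      unfolding uv(3,4)[symmetric] using A(1,3) assms(1,3) c by algebra
    finally show ?case
      unfolding pq using A assms uv M_mult by (auto simp: fraction_eq_iff)
  qed (use fraction_self assms in auto)
  then show ?thesis by (simp add: localization_def)
qed

lemma add_fraction:
  assumes "a \<in> carrier A" "s \<in> M" "b \<in> carrier A" "t \<in> M"
  shows "fraction A M a s \<oplus>\<^bsub>Loc\<^esub> fraction A M b t
       = fraction A M ((a \<otimes> t) \<oplus> (b \<otimes> s)) (s \<otimes> t)"
proof -
  have "frac_add A M (fraction A M a s) (fraction A M b t)
      = (\<lambda>(a, s) (b, t). fraction A M ((a \<otimes> t) \<oplus> (b \<otimes> s)) (s \<otimes> t)) (a, s) (b, t)"
    unfolding frac_add_def case_prod_unfold
  proof (rule UN_UN_const, goal_cases)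
    case (3 p q)
    obtain a' s' b' t' where pq: "p = (a', s')" "q = (b', t')" by fastforce
    obtain u v where uv: "u \<in> M" "v \<in> M" "u \<otimes> (a \<otimes> s') = u \<otimes> (a' \<otimes> s)"
        "v \<otimes> (b \<otimes> t') = v \<otimes> (b' \<otimes> t)"
      and A: "a' \<in> carrier A" "s' \<in> M" "b' \<in> carrier A" "t' \<in> M"
      using 3 unfolding pq fraction_mem_iff frac_rel_iff by blast
    have c: "s \<in> carrier A" "t \<in> carrier A" "s' \<in> carrier A" "t' \<in> carrier A"
        "u \<in> carrier A" "v \<in> carrier A"
      using A assms uv by auto
    have "(u \<otimes> v) \<otimes> (((a' \<otimes> t') \<oplus> (b' \<otimes> s')) \<otimes> (s \<otimes> t))
        = (v \<otimes> t \<otimes> t') \<otimes> (u \<otimes> (a' \<otimes> s)) \<oplus> (u \<otimes> s \<otimes> s') \<otimes> (v \<otimes> (b' \<otimes> t))"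
      using A(1,3) assms(1,3) c by algebra
    also have "\<dots> = (u \<otimes> v) \<otimes> (((a \<otimes> t) \<oplus> (b \<otimes> s)) \<otimes> (s' \<otimes> t'))"
      unfolding uv(3,4)[symmetric] using A(1,3) assms(1,3) c by algebra
    finally show ?case
      unfolding pq using A assms uv M_mult by (auto simp: fraction_eq_iff)
  qed (use fraction_self assms in auto)
  then show ?thesis by (simp add: localization_def)
qed

lemma one_Loc: "\<one>\<^bsub>Loc\<^esub> = fraction A M \<one> \<one>"
  and zero_Loc: "\<zero>\<^bsub>Loc\<^esub> = fraction A M \<zero> \<one>"
  by (simp_all add: localization_def)

lemma cring_Loc: "cring Loc"
proof (rule cringI)
  show "abelian_group Loc"
  proof (rule abelian_groupI; clarsimp simp: carrier_Loc zero_Loc)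
    fix a s b t assume A: "a \<in> carrier A" "s \<in> M" "b \<in> carrier A" "t \<in> M"
    then have c: "s \<in> carrier A" "t \<in> carrier A" by auto
    show "\<exists>c w. fraction A M a s \<oplus>\<^bsub>Loc\<^esub> fraction A M b t = fraction A M c w
        \<and> c \<in> carrier A \<and> w \<in> M"
      unfolding add_fraction[OF A] using A c M_mult by blast
    show "fraction A M a s \<oplus>\<^bsub>Loc\<^esub> fraction A M b t
        = fraction A M b t \<oplus>\<^bsub>Loc\<^esub> fraction A M a s"
      using A c by (simp add: add_fraction a_comm m_comm)
  next
    fix a s b t d w assume A: "a \<in> carrier A" "s \<in> M" "b \<in> carrier A" "t \<in> M" "d \<in> carrier A" "w \<in> M"
    then have c: "s \<in> carrier A" "t \<in> carrier A" "w \<in> carrier A" by auto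
    show "fraction A M a s \<oplus>\<^bsub>Loc\<^esub> fraction A M b t \<oplus>\<^bsub>Loc\<^esub> fraction A M d w
        = fraction A M a s \<oplus>\<^bsub>Loc\<^esub> (fraction A M b t \<oplus>\<^bsub>Loc\<^esub> fraction A M d w)"
    proof -
      have "((a \<otimes> t \<oplus> b \<otimes> s) \<otimes> w \<oplus> d \<otimes> (s \<otimes> t)) = (a \<otimes> (t \<otimes> w) \<oplus> (b \<otimes> w \<oplus> d \<otimes> t) \<otimes> s)"
        using A(1,3,5) c by algebra
      then show ?thesis using A c M_mult by (simp add: add_fraction m_assoc)
    qed
  next
    fix a s assume A: "a \<in> carrier A" "s \<in> M"
    then show "fraction A M \<zero> \<one> \<oplus>\<^bsub>Loc\<^esub> fraction A M a s = fraction A M a s"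
      using M_one by (simp add: add_fraction)
    have "fraction A M (\<ominus> a) s \<oplus>\<^bsub>Loc\<^esub> fraction A M a s = fraction A M \<zero> \<one>"
      using A M_one M_mult fraction_eqI[of \<zero> "s \<otimes> s" \<zero> \<one>]
      by (simp add: add_fraction l_minus l_neg)
    then show "\<exists>x. (\<exists>b t. x = fraction A M b t \<and> b \<in> carrier A \<and> t \<in> M)
        \<and> x \<oplus>\<^bsub>Loc\<^esub> fraction A M a s = fraction A M \<zero> \<one>"
      using A a_inv_closed by metis
  qed (use M_one in blast)
  show "comm_monoid Loc"
  proof (rule comm_monoidI; clarsimp simp: carrier_Loc one_Loc)
    fix a s b t assume A: "a \<in> carrier A" "s \<in> M" "b \<in> carrier A" "t \<in> M"
    then have c: "s \<in> carrier A" "t \<in> carrier A" by auto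
    show "\<exists>c w. fraction A M a s \<otimes>\<^bsub>Loc\<^esub> fraction A M b t = fraction A M c w
        \<and> c \<in> carrier A \<and> w \<in> M"
      unfolding mult_fraction[OF A] using A c M_mult by blast
    show "fraction A M a s \<otimes>\<^bsub>Loc\<^esub> fraction A M b t
        = fraction A M b t \<otimes>\<^bsub>Loc\<^esub> fraction A M a s"
      using A c by (simp add: mult_fraction m_comm)
  next
    fix a s b t d w assume "a \<in> carrier A" "s \<in> M" "b \<in> carrier A" "t \<in> M" "d \<in> carrier A" "w \<in> M"
    then show "fraction A M a s \<otimes>\<^bsub>Loc\<^esub> fraction A M b t \<otimes>\<^bsub>Loc\<^esub> fraction A M d w
        = fraction A M a s \<otimes>\<^bsub>Loc\<^esub> (fraction A M b t \<otimes>\<^bsub>Loc\<^esub> fraction A M d w)"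
      using M_mult by (simp add: mult_fraction m_assoc)
  next
    fix a s assume "a \<in> carrier A" "s \<in> M"
    then show "fraction A M \<one> \<one> \<otimes>\<^bsub>Loc\<^esub> fraction A M a s = fraction A M a s"
      using M_one by (simp add: mult_fraction)
  qed (use M_one in blast)
  fix x y z assume "x \<in> carrier Loc" "y \<in> carrier Loc" "z \<in> carrier Loc"
  then obtain a s b t d w where xyz: "x = fraction A M a s" "y = fraction A M b t" "z = fraction A M d w"
    and A: "a \<in> carrier A" "s \<in> M" "b \<in> carrier A" "t \<in> M" "d \<in> carrier A" "w \<in> M"
    unfolding carrier_Loc by blast
  then have c: "s \<in> carrier A" "t \<in> carrier A" "w \<in> carrier A" by auto
  have "(a \<otimes> t \<oplus> b \<otimes> s) \<otimes> d \<otimes> (s \<otimes> w \<otimes> (t \<otimes> w))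
      = (a \<otimes> d \<otimes> (t \<otimes> w) \<oplus> b \<otimes> d \<otimes> (s \<otimes> w)) \<otimes> (s \<otimes> t \<otimes> w)"
    using A(1,3,5) c by algebra
  then have "fraction A M ((a \<otimes> t \<oplus> b \<otimes> s) \<otimes> d) (s \<otimes> t \<otimes> w)
      = fraction A M (a \<otimes> d \<otimes> (t \<otimes> w) \<oplus> b \<otimes> d \<otimes> (s \<otimes> w)) (s \<otimes> w \<otimes> (t \<otimes> w))"
    by (intro fraction_eqI M_mult A m_closed a_closed c)
  moreover have "(x \<oplus>\<^bsub>Loc\<^esub> y) \<otimes>\<^bsub>Loc\<^esub> z = fraction A M ((a \<otimes> t \<oplus> b \<otimes> s) \<otimes> d) (s \<otimes> t \<otimes> w)"
    unfolding xyz add_fraction[OF A(1-4)]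
    by (intro mult_fraction M_mult A m_closed a_closed c)
  moreover have "x \<otimes>\<^bsub>Loc\<^esub> z \<oplus>\<^bsub>Loc\<^esub> y \<otimes>\<^bsub>Loc\<^esub> z
      = fraction A M (a \<otimes> d \<otimes> (t \<otimes> w) \<oplus> b \<otimes> d \<otimes> (s \<otimes> w)) (s \<otimes> w \<otimes> (t \<otimes> w))"
    unfolding xyz mult_fraction[OF A(1,2,5,6)] mult_fraction[OF A(3,4,5,6)]
    by (intro add_fraction M_mult A m_closed a_closed c)
  ultimately show "(x \<oplus>\<^bsub>Loc\<^esub> y) \<otimes>\<^bsub>Loc\<^esub> z = x \<otimes>\<^bsub>Loc\<^esub> z \<oplus>\<^bsub>Loc\<^esub> y \<otimes>\<^bsub>Loc\<^esub> z"
    by simp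
qed

lemma minus_fraction:
  assumes "a \<in> carrier A" "s \<in> M"
  shows "\<ominus>\<^bsub>Loc\<^esub> fraction A M a s = fraction A M (\<ominus> a) s"
proof -
  interpret L: cring Loc by (rule cring_Loc)
  have "fraction A M (\<ominus> a) s \<oplus>\<^bsub>Loc\<^esub> fraction A M a s = \<zero>\<^bsub>Loc\<^esub>"
    using assms M_one M_mult fraction_eqI[of \<zero> "s \<otimes> s" \<zero> \<one>]
    by (simp add: add_fraction zero_Loc l_minus l_neg)
  then show ?thesis
    using assms by (intro L.minus_equality) auto
qed

end

section \<open>Prime ideals avoiding a multiplicative subset\<close>

text \<open>
  An ideal that is maximal among those that contain \<open>I\<close> and miss \<open>N\<close> is prime: if it contains
  neither \<open>a\<close> nor \<open>b\<close>, then enlarging it by \<open>a\<close> and by \<open>b\<close> produces two elements of \<open>N\<close>, and their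
  product lies in the enlargement by \<open>a b\<close>.
\<close>

lemma (in cring) exists_primeideal_avoiding:
  assumes "ideal I R" and "multiplicative_subset R N" and "I \<inter> N = {}"
  shows "\<exists>Q. primeideal Q R \<and> I \<subseteq> Q \<and> Q \<inter> N = {}"
proof -
  interpret N: multiplicative_subset R N by fact
  define \<A> where "\<A> = {J. ideal J R \<and> I \<subseteq> J \<and> J \<inter> N = {}}"
  have "\<exists>Q \<in> \<A>. \<forall>J \<in> \<A>. Q \<subseteq> J \<longrightarrow> J = Q"
  proof (rule subset_Zorn)
    fix C assume C: "subset.chain \<A> C"
    show "\<exists>U \<in> \<A>. \<forall>J \<in> C. J \<subseteq> U"
    proof (cases "C = {}")
      case True
      then show ?thesis using assms by (auto simp: \<A>_def)
    next
      case False
      have "subset.chain {J. ideal J R} C"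
        using C by (auto simp: \<A>_def pred_on.chain_def)
      then have "ideal (\<Union>C) R"
        using chain_Union_is_ideal[of C] False by simp
      moreover have "\<forall>J \<in> C. I \<subseteq> J \<and> J \<inter> N = {}"
        using C by (auto simp: \<A>_def pred_on.chain_def)
      ultimately have "\<Union>C \<in> \<A>" using False by (auto simp: \<A>_def)
      then show ?thesis by blast
    qed
  qed
  then obtain Q where Q_mem: "Q \<in> \<A>" and Q_max: "\<forall>J \<in> \<A>. Q \<subseteq> J \<longrightarrow> J = Q"
    by blast
  have Q: "ideal Q R" "I \<subseteq> Q" "Q \<inter> N = {}"
    using Q_mem by (simp_all add: \<A>_def)
  have max: "J = Q" if "ideal J R" "Q \<subseteq> J" "J \<inter> N = {}" for J
    using Q_max that Q(2) by (simp add: \<A>_def)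
  interpret Q: ideal Q R by fact
  have hit: "\<exists>q x. q \<in> Q \<and> x \<in> carrier R \<and> q \<oplus> x \<otimes> a \<in> N" if a: "a \<in> carrier R" "a \<notin> Q" for a
  proof -
    define J where "J = Q <+>\<^bsub>R\<^esub> PIdl a"
    have J: "ideal J R"
      unfolding J_def
      by (intro add_ideals Q(1) cgenideal_ideal a)
    have mem: "z \<in> J \<longleftrightarrow> (\<exists>q \<in> Q. \<exists>x \<in> carrier R. z = q \<oplus> x \<otimes> a)" for z
      by (auto simp: J_def set_add_def' cgenideal_def)
    have "Q \<subseteq> J"
    proof
      fix q assume "q \<in> Q"
      then have "q = q \<oplus> \<zero> \<otimes> a" using a by (simp add: Q.Icarr)
      then show "q \<in> J"
        unfolding mem using \<open>q \<in> Q\<close> zero_closed by blast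
    qed
    moreover have "a \<in> J"
    proof -
      have "a = \<zero> \<oplus> \<one> \<otimes> a" using a by simp
      then show ?thesis
        unfolding mem using Q.zero_closed one_closed by blast
    qed
    ultimately have "(J) \<inter> N \<noteq> {}" using max[OF J] a by auto
    then obtain z where "z \<in> J" "z \<in> N" by blast
    then show ?thesis unfolding mem by blast
  qed
  have "primeideal Q R"
  proof (rule primeidealI[OF Q(1) is_cring])
    show "carrier R \<noteq> Q" using Q(3) N.M_one by blast
    fix a b assume ab: "a \<in> carrier R" "b \<in> carrier R" "a \<otimes> b \<in> Q"
    show "a \<in> Q \<or> b \<in> Q"
    proof (rule ccontr)
      assume "\<not> ?thesis"
      with hit ab obtain p x q y where pq: "p \<in> Q" "x \<in> carrier R" "p \<oplus> x \<otimes> a \<in> N"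
          "q \<in> Q" "y \<in> carrier R" "q \<oplus> y \<otimes> b \<in> N" by metis
      have "(p \<oplus> x \<otimes> a) \<otimes> (q \<oplus> y \<otimes> b) = (q \<oplus> y \<otimes> b) \<otimes> p \<oplus> (x \<otimes> a) \<otimes> q \<oplus> (x \<otimes> y) \<otimes> (a \<otimes> b)"
        using pq(2,5) ab(1,2) Q.Icarr[OF pq(1)] Q.Icarr[OF pq(4)] by algebra
      also have "\<dots> \<in> Q"
        using pq ab by (intro Q.a_closed Q.I_l_closed[OF pq(1)] Q.I_l_closed[OF pq(4)] Q.I_l_closed[OF ab(3)])
          auto
      finally show False using N.M_mult pq Q(3) by blast
    qed
  qed
  then show ?thesis using Q by blast
qed

section \<open>Modules over the base ring and integral elements\<close>

locale ring_extension = cring S for S (structure) +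
  fixes R
  assumes subring_R: "subring R S"
begin

lemma R_carrier [simp]: "r \<in> R \<Longrightarrow> r \<in> carrier S"
  using subringE(1)[OF subring_R] by blast

lemma R_closed [simp]:
  shows "\<zero> \<in> R" and "\<one> \<in> R" and "r \<in> R \<Longrightarrow> \<ominus> r \<in> R"
    and "\<lbrakk>r \<in> R; s \<in> R\<rbrakk> \<Longrightarrow> r \<otimes> s \<in> R" and "\<lbrakk>r \<in> R; s \<in> R\<rbrakk> \<Longrightarrow> r \<oplus> s \<in> R"
  using subringE[OF subring_R] by auto

lemma R_minus [simp]: "\<lbrakk>r \<in> R; s \<in> R\<rbrakk> \<Longrightarrow> r \<ominus> s \<in> R"
  by (simp add: minus_eq)

lemma R_pow [simp]: "r \<in> R \<Longrightarrow> r [^] (n :: nat) \<in> R"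
  by (induction n) auto

definition submod :: "'a set \<Rightarrow> bool" where
  "submod E \<longleftrightarrow> E \<subseteq> carrier S \<and> \<zero> \<in> E \<and> (\<forall>x \<in> E. \<forall>y \<in> E. x \<oplus> y \<in> E)
     \<and> (\<forall>r \<in> R. \<forall>x \<in> E. r \<otimes> x \<in> E)"

lemma submodI:
  assumes "E \<subseteq> carrier S" "\<zero> \<in> E" "\<And>x y. \<lbrakk>x \<in> E; y \<in> E\<rbrakk> \<Longrightarrow> x \<oplus> y \<in> E"
    "\<And>r x. \<lbrakk>r \<in> R; x \<in> E\<rbrakk> \<Longrightarrow> r \<otimes> x \<in> E"
  shows "submod E"
  using assms by (auto simp: submod_def)

lemma submodD:
  assumes "submod E"
  shows "x \<in> E \<Longrightarrow> x \<in> carrier S" and "\<zero> \<in> E" and "\<lbrakk>x \<in> E; y \<in> E\<rbrakk> \<Longrightarrow> x \<oplus> y \<in> E"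
    and "\<lbrakk>r \<in> R; x \<in> E\<rbrakk> \<Longrightarrow> r \<otimes> x \<in> E"
  using assms by (auto simp: submod_def)

lemma submod_uminus:
  assumes "submod E" "x \<in> E"
  shows "\<ominus> x \<in> E"
proof -
  have "(\<ominus> \<one>) \<otimes> x \<in> E" using assms by (intro submodD(4)[OF assms(1)]) auto
  then show ?thesis using assms submodD(1)[OF assms] by (simp add: l_minus)
qed

lemma submod_minus: "\<lbrakk>submod E; x \<in> E; y \<in> E\<rbrakk> \<Longrightarrow> x \<ominus> y \<in> E"
  unfolding minus_eq by (intro submodD(3) submod_uminus)

lemma submod_subalgebra:
  assumes "T \<in> subalgebras S R"
  shows "submod T"
  using assms subringE[of T S] by (intro submodI) (auto simp: subalgebras_def)

lemma R_subalgebra: "R \<in> subalgebras S R"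
  using subring_R by (simp add: subalgebras_def)

lemma submod_R: "submod R"
  by (intro submodI) auto

lemma Span_Cons_iff:
  "x \<in> Span K (c # cs) \<longleftrightarrow> (\<exists>k \<in> K. \<exists>v \<in> Span K cs. x = k \<otimes> c \<oplus> v)"
  by (simp add: line_extension_mem_iff)

declare Span.simps [simp del]

lemma Span_Nil: "Span K [] = {\<zero>}"
  by (simp add: Span.simps)

lemma submod_Span: "set cs \<subseteq> carrier S \<Longrightarrow> submod (Span R cs)"
proof (induction cs)
  case Nil
  show ?case by (intro submodI) (auto simp: Span_Nil)
next
  case (Cons c cs)
  then have c: "c \<in> carrier S" and IH: "submod (Span R cs)" by auto
  note IHD = submodD[OF IH]
  show ?case
  proof (rule submodI)
    show "Span R (c # cs) \<subseteq> carrier S"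
      using Cons.prems by (intro Span_in_carrier) auto
    have "\<zero> = \<zero> \<otimes> c \<oplus> \<zero>" using c by simp
    then show "\<zero> \<in> Span R (c # cs)"
      unfolding Span_Cons_iff using IHD(2) R_closed(1) by blast
  next
    fix x y assume "x \<in> Span R (c # cs)" "y \<in> Span R (c # cs)"
    then obtain k v l w where kv: "k \<in> R" "v \<in> Span R cs" "x = k \<otimes> c \<oplus> v"
      "l \<in> R" "w \<in> Span R cs" "y = l \<otimes> c \<oplus> w"
      unfolding Span_Cons_iff by blast
    have "x \<oplus> y = (k \<oplus> l) \<otimes> c \<oplus> (v \<oplus> w)"
      unfolding kv using R_carrier[OF kv(1)] R_carrier[OF kv(4)] IHD(1)[OF kv(2)] IHD(1)[OF kv(5)] c
      by algebra
    then show "x \<oplus> y \<in> Span R (c # cs)"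
      unfolding Span_Cons_iff using kv IHD(3) R_closed(5) by blast
  next
    fix r x assume r: "r \<in> R" and "x \<in> Span R (c # cs)"
    then obtain k v where kv: "k \<in> R" "v \<in> Span R cs" "x = k \<otimes> c \<oplus> v"
      unfolding Span_Cons_iff by blast
    have "r \<otimes> x = (r \<otimes> k) \<otimes> c \<oplus> r \<otimes> v"
      unfolding kv using R_carrier[OF kv(1)] R_carrier[OF r] IHD(1)[OF kv(2)] c
      by algebra
    then show "r \<otimes> x \<in> Span R (c # cs)"
      unfolding Span_Cons_iff using kv IHD(4) R_closed(4) r by blast
  qed
qed

lemma set_subset_Span: "set cs \<subseteq> carrier S \<Longrightarrow> set cs \<subseteq> Span R cs"
proof (induction cs)
  case (Cons c cs)
  note D = submodD[OF submod_Span, of cs]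
  have zero: "\<zero> \<in> Span R cs" using D(2) Cons.prems by simp
  have "c = \<one> \<otimes> c \<oplus> \<zero>" using Cons.prems by simp
  then have "c \<in> Span R (c # cs)"
    unfolding Span_Cons_iff using zero R_closed(2) by blast
  moreover have "x \<in> Span R (c # cs)" if "x \<in> Span R cs" for x
  proof -
    have "x = \<zero> \<otimes> c \<oplus> x" using Cons.prems D(1)[OF _ that] by simp
    then show ?thesis unfolding Span_Cons_iff using that R_closed(1) by blast
  qed
  ultimately show ?case using Cons by auto
qed simp

lemma Span_subset:
  assumes E: "submod E"
  shows "set cs \<subseteq> E \<Longrightarrow> Span R cs \<subseteq> E"
proof (induction cs)
  case Nil
  show ?case using submodD(2)[OF E] by (simp add: Span_Nil)
next
  case (Cons c cs)
  show ?case
  proof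
    fix x assume "x \<in> Span R (c # cs)"
    then obtain k v where "k \<in> R" "v \<in> Span R cs" "x = k \<otimes> c \<oplus> v"
      unfolding Span_Cons_iff by blast
    with Cons show "x \<in> E" using submodD(3,4)[OF E] by auto
  qed
qed

lemma eval_in_Span_powers:
  "set q \<subseteq> R \<Longrightarrow> eval q x \<in> Span R (map (\<lambda>i. x [^] i) (rev [0..<length q]))"
proof (induction q)
  case (Cons a q)
  then have "eval q x \<in> Span R (map (\<lambda>i. x [^] i) (rev [0..<length q]))" "a \<in> R" by auto
  moreover have "eval (a # q) x = a \<otimes> x [^] length q \<oplus> eval q x" by simp
  ultimately show ?case by (simp only: length_Cons upt_Suc rev_append) (auto simp: Span_Cons_iff)
qed (simp add: Span_Nil)

text \<open>
  The subalgebra is \<open>R[x]\<close>. A monic equation of degree \<open>d\<close> for \<open>x\<close> expresses \<open>x\<^sup>d\<close> by lower powers, so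
  the module spanned by the powers \<open>x\<^sup>i\<close> with \<open>i < d\<close> is stable under multiplication by \<open>x\<close>, hence
  by all of \<open>R[x]\<close>; and it contains 1.
\<close>

lemma integral_imp_finite_subalgebra:
  assumes "integral_extension S R" and x: "x \<in> carrier S"
  obtains Y cs where "Y \<in> subalgebras S R" "x \<in> Y" "set cs \<subseteq> Y" "Y \<subseteq> Span R cs"
proof -
  obtain p where p: "p \<in> carrier (univ_poly S R)" "p \<noteq> []" "lead_coeff p = \<one>" "eval p x = \<zero>"
    using assms unfolding integral_extension_def by blast
  then obtain q where pq: "p = \<one> # q" by (cases p) auto
  have q: "set q \<subseteq> R"
    using p(1) by (auto simp: pq univ_poly_carrier[symmetric] polynomial_def)
  define d where "d = length q"
  define cs where "cs = map (\<lambda>i. x [^] i) (rev [0..<d])"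
  define W where "W = Span R cs"
  define Y where "Y = generate_ring S (insert x R)"
  have cs: "set cs \<subseteq> carrier S" using x by (auto simp: cs_def)
  have W: "submod W" unfolding W_def by (rule submod_Span[OF cs])
  note WD = submodD[OF W]
  have eval_q: "eval q x \<in> W"
    using eval_in_Span_powers[OF q] by (simp add: W_def cs_def d_def)
  have "x [^] d \<oplus> eval q x = \<zero>"
    using p(4) x by (simp add: pq d_def)
  then have "x [^] d = \<ominus> eval q x"
    using x WD(1)[OF eval_q] by (simp add: minus_equality[symmetric] )
  then have top: "x [^] d \<in> W"
    using submod_uminus[OF W eval_q] by simp
  \<comment> \<open>Including \<open>i = d\<close> has the effect that 1 lies in \<open>W\<close> even for \<open>d = 0\<close>, where \<open>S\<close> is the zero ring.\<close>
  have pow: "x [^] i \<in> W" if "i \<le> d" for i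
  proof (cases "i = d")
    case False
    then have "x [^] i \<in> set cs" using that by (auto simp: cs_def)
    then show ?thesis using set_subset_Span[OF cs] by (auto simp: W_def)
  qed (use top in simp)
  have xW: "x \<otimes> w \<in> W" if "w \<in> W" for w
  proof -
    have "submod {w \<in> carrier S. x \<otimes> w \<in> W}"
      using x WD by (intro submodI) (auto simp: r_distr m_lcomm)
    moreover have "set cs \<subseteq> {w \<in> carrier S. x \<otimes> w \<in> W}"
    proof
      fix c assume "c \<in> set cs"
      then obtain i where i: "i < d" "c = x [^] i" by (auto simp: cs_def)
      then have "x \<otimes> c = x [^] Suc i" using x by (simp add: m_comm)
      then show "c \<in> {w \<in> carrier S. x \<otimes> w \<in> W}"
        using pow[of "Suc i"] i x by (simp del: nat_pow_Suc)
    qed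
    ultimately have "W \<subseteq> {w \<in> carrier S. x \<otimes> w \<in> W}"
      unfolding W_def by (rule Span_subset)
    then show ?thesis using that by blast
  qed
  \<comment> \<open>The multipliers of \<open>W\<close> form a ring, which therefore contains \<open>R[x]\<close>.\<close>
  define U where "U = {v \<in> carrier S. \<forall>w \<in> W. v \<otimes> w \<in> W}"
  have xR: "insert x R \<subseteq> carrier S" using x by auto
  have subY: "subring Y S" unfolding Y_def by (rule generate_ring_is_subring[OF xR])
  have incl: "insert x R \<subseteq> Y" unfolding Y_def by (auto intro: generate_ring.incl)
  show ?thesis
  proof (rule that[of Y cs])
    show "Y \<in> subalgebras S R" using subY incl by (auto simp: subalgebras_def)
    show "x \<in> Y" using incl by blast
    have "x [^] i \<in> Y" for i :: nat
      by (induction i) (use subringE[OF subY] incl in auto)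
    then show "set cs \<subseteq> Y" by (auto simp: cs_def)
    have "subring U S"
    proof (rule subringI)
      show "U \<subseteq> carrier S" by (auto simp: U_def)
      show "\<one> \<in> U" using WD(1) by (auto simp: U_def)
    next
      fix h assume h: "h \<in> U"
      then show "\<ominus> h \<in> U"
        using WD(1) submod_uminus[OF W] by (auto simp: U_def l_minus)
    next
      fix h k assume "h \<in> U" "k \<in> U"
      then show "h \<otimes> k \<in> U" "h \<oplus> k \<in> U"
        using WD(1,3) by (auto simp: U_def m_assoc l_distr)
    qed
    moreover have "insert x R \<subseteq> U"
      using x xW WD(4) by (auto simp: U_def)
    ultimately have YU: "Y \<subseteq> U"
      unfolding Y_def by (intro generate_ring_min_subring1[OF xR])
    show "Y \<subseteq> Span R cs"
    proof
      fix v assume "v \<in> Y"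
      with YU have "v \<in> U" by blast
      then have "v \<otimes> \<one> \<in> W" using pow[of 0] by (auto simp: U_def)
      then show "v \<in> Span R cs" using \<open>v \<in> U\<close> by (simp add: U_def W_def)
    qed
  qed
qed

end

section \<open>Saturation at a prime of the base ring\<close>

locale ring_extension_prime = ring_extension S R for S (structure) and R +
  fixes P
  assumes prime_P: "primeideal P (S\<lparr>carrier := R\<rparr>)"
begin

lemma P_R [simp]: "p \<in> P \<Longrightarrow> p \<in> R"
  using ideal.Icarr[OF primeideal.axioms(1)[OF prime_P]] by simp

lemma P_closed [simp]:
  shows "\<zero> \<in> P" and "\<lbrakk>p \<in> P; q \<in> P\<rbrakk> \<Longrightarrow> p \<oplus> q \<in> P"
    and "\<lbrakk>r \<in> R; p \<in> P\<rbrakk> \<Longrightarrow> r \<otimes> p \<in> P" and "\<lbrakk>r \<in> R; p \<in> P\<rbrakk> \<Longrightarrow> p \<otimes> r \<in> P"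
proof -
  interpret I: ideal P "S\<lparr>carrier := R\<rparr>" by (rule primeideal.axioms(1)[OF prime_P])
  show "\<zero> \<in> P" "\<lbrakk>p \<in> P; q \<in> P\<rbrakk> \<Longrightarrow> p \<oplus> q \<in> P"
    "\<lbrakk>r \<in> R; p \<in> P\<rbrakk> \<Longrightarrow> r \<otimes> p \<in> P" "\<lbrakk>r \<in> R; p \<in> P\<rbrakk> \<Longrightarrow> p \<otimes> r \<in> P"
    using additive_subgroup.zero_closed[OF I.is_additive_subgroup]
      additive_subgroup.a_closed[OF I.is_additive_subgroup] I.I_l_closed I.I_r_closed by auto
qed

lemma P_prime: "\<lbrakk>r \<in> R; s \<in> R; r \<otimes> s \<in> P\<rbrakk> \<Longrightarrow> r \<in> P \<or> s \<in> P"
  using primeideal.I_prime[OF prime_P] by simp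

lemma one_notin_P: "\<one> \<notin> P"
proof
  assume "\<one> \<in> P"
  then have "r \<in> P" if "r \<in> R" for r using P_closed(3)[OF that, of \<one>] that by simp
  then show False using primeideal.I_notcarr[OF prime_P] by auto
qed

lemma P_uminus [simp]: "p \<in> P \<Longrightarrow> \<ominus> p \<in> P"
  using P_closed(3)[of "\<ominus> \<one>" p] by (simp add: l_minus)

definition N where "N = R - P"

sublocale N: multiplicative_subset S N
  by unfold_locales (use one_notin_P P_prime in \<open>auto simp: N_def\<close>)

lemma N_iff: "u \<in> N \<longleftrightarrow> u \<in> R \<and> u \<notin> P"
  by (simp add: N_def)

lemma N_R [simp]: "u \<in> N \<Longrightarrow> u \<in> R"
  by (simp add: N_iff)

lemma N_not_P: "u \<in> N \<Longrightarrow> u \<notin> P"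
  by (simp add: N_def)

lemma N_mult [simp]: "\<lbrakk>u \<in> N; v \<in> N\<rbrakk> \<Longrightarrow> u \<otimes> v \<in> N"
  by (rule N.M_mult)

lemma N_minus_P:
  assumes "u \<in> N" "p \<in> P"
  shows "u \<ominus> p \<in> N"
proof -
  have eq: "(u \<ominus> p) \<oplus> p = u"
    using R_carrier[of u] R_carrier[OF P_R[OF assms(2)]] assms(1) by (simp add: minus_eq a_assoc l_neg)
  have "u \<ominus> p \<notin> P"
  proof
    assume "u \<ominus> p \<in> P"
    then have "(u \<ominus> p) \<oplus> p \<in> P" using assms(2) by (rule P_closed(2))
    then show False using assms(1) unfolding eq by (simp add: N_iff)
  qed
  then show ?thesis using assms by (simp add: N_iff)
qed

text \<open>
  The preimage in \<open>S\<close> of the localization of \<open>E\<close> at \<open>P\<close>. Thus \<open>sat R\<close> consists of the elements of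
  \<open>S\<close> whose image in \<open>S\<^sub>P\<close> lies in \<open>R\<^sub>P\<close>, and \<open>sat P\<close> of those whose image lies in \<open>P R\<^sub>P\<close>.
\<close>

definition sat :: "'a set \<Rightarrow> 'a set" where
  "sat E = {x \<in> carrier S. \<exists>u \<in> N. u \<otimes> x \<in> E}"

definition saturated :: "'a set \<Rightarrow> bool" where
  "saturated E \<longleftrightarrow> (\<forall>u \<in> N. \<forall>x \<in> carrier S. u \<otimes> x \<in> E \<longrightarrow> x \<in> E)"

lemma saturatedD: "\<lbrakk>saturated E; u \<in> N; x \<in> carrier S; u \<otimes> x \<in> E\<rbrakk> \<Longrightarrow> x \<in> E"
  unfolding saturated_def by blast

lemma satI: "\<lbrakk>x \<in> carrier S; u \<in> N; u \<otimes> x \<in> E\<rbrakk> \<Longrightarrow> x \<in> sat E"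
  unfolding sat_def by blast

lemma sat_carrier: "x \<in> sat E \<Longrightarrow> x \<in> carrier S"
  by (simp add: sat_def)

lemma subset_sat:
  assumes "E \<subseteq> carrier S"
  shows "E \<subseteq> sat E"
proof
  fix x assume "x \<in> E"
  then show "x \<in> sat E" using assms by (intro satI[OF _ N.M_one]) auto
qed

lemma sat_mono: "E \<subseteq> F \<Longrightarrow> sat E \<subseteq> sat F"
  by (auto simp: sat_def)

lemma sat_subset: "\<lbrakk>E \<subseteq> F; saturated F\<rbrakk> \<Longrightarrow> sat E \<subseteq> F"
  by (auto simp: sat_def saturated_def)

lemma saturated_sat: "saturated (sat E)"
  unfolding saturated_def
proof (intro ballI impI)
  fix u x assume "u \<in> N" and x: "x \<in> carrier S" and "u \<otimes> x \<in> sat E"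
  then obtain v where v: "v \<in> N" "v \<otimes> (u \<otimes> x) \<in> E" by (auto simp: sat_def)
  then show "x \<in> sat E"
    using x \<open>u \<in> N\<close> by (intro satI[of x "v \<otimes> u"]) (auto simp: m_assoc)
qed

lemma submod_sat:
  assumes "submod E"
  shows "submod (sat E)"
proof (rule submodI)
  show "sat E \<subseteq> carrier S" by (auto simp: sat_def)
  show "\<zero> \<in> sat E" using subset_sat submodD(1,2)[OF assms] by blast
next
  fix x y assume "x \<in> sat E" "y \<in> sat E"
  then obtain u v where uv: "u \<in> N" "u \<otimes> x \<in> E" "v \<in> N" "v \<otimes> y \<in> E"
    and xy: "x \<in> carrier S" "y \<in> carrier S"
    by (auto simp: sat_def)
  then have c: "u \<in> carrier S" "v \<in> carrier S" by auto
  have "(u \<otimes> v) \<otimes> (x \<oplus> y) = v \<otimes> (u \<otimes> x) \<oplus> u \<otimes> (v \<otimes> y)"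
    using xy c by algebra
  also have "\<dots> \<in> E" using uv by (simp add: submodD(3,4)[OF assms])
  finally show "x \<oplus> y \<in> sat E" using uv xy by (intro satI[of _ "u \<otimes> v"]) auto
next
  fix r x assume "r \<in> R" "x \<in> sat E"
  then obtain u where u: "u \<in> N" "u \<otimes> x \<in> E" and x: "x \<in> carrier S"
    by (auto simp: sat_def)
  have "u \<otimes> (r \<otimes> x) = r \<otimes> (u \<otimes> x)"
    using u x \<open>r \<in> R\<close> by (simp add: m_lcomm)
  also have "\<dots> \<in> E" using u \<open>r \<in> R\<close> by (simp add: submodD(4)[OF assms])
  finally show "r \<otimes> x \<in> sat E" using u x \<open>r \<in> R\<close> by (intro satI[of _ u]) auto
qed

lemma sat_subalgebra:
  assumes T: "T \<in> subalgebras S R"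
  shows "sat T \<in> subalgebras S R"
proof -
  have sub: "subring T S" "R \<subseteq> T" using T by (auto simp: subalgebras_def)
  note sm = submod_sat[OF submod_subalgebra[OF T]]
  have RT: "R \<subseteq> sat T" using sub subset_sat subringE(1)[OF sub(1)] by blast
  moreover have "subring (sat T) S"
  proof (rule subringI)
    show "sat T \<subseteq> carrier S" by (auto simp: sat_def)
    show "\<one> \<in> sat T" using RT by auto
  next
    fix h assume "h \<in> sat T"
    then show "\<ominus> h \<in> sat T" by (rule submod_uminus[OF sm])
  next
    fix x y assume xy: "x \<in> sat T" "y \<in> sat T"
    then show "x \<oplus> y \<in> sat T" by (rule submodD(3)[OF sm])
    from xy obtain u v where uv: "u \<in> N" "u \<otimes> x \<in> T" "v \<in> N" "v \<otimes> y \<in> T"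
      and c: "x \<in> carrier S" "y \<in> carrier S"
      by (auto simp: sat_def)
    then have uvc: "u \<in> carrier S" "v \<in> carrier S" by auto
    have "(u \<otimes> v) \<otimes> (x \<otimes> y) = (u \<otimes> x) \<otimes> (v \<otimes> y)"
      using c uvc by algebra
    also have "\<dots> \<in> T" using uv by (intro subringE(6)[OF sub(1), of "u \<otimes> x"]) auto
    finally show "x \<otimes> y \<in> sat T" using uv c by (intro satI[of _ "u \<otimes> v"]) auto
  qed
  ultimately show ?thesis by (simp add: subalgebras_def)
qed

end

section \<open>Nakayama's lemma and the conductor\<close>

context ring_extension_prime
begin

lemma submod_colon:
  assumes "submod E" "a \<in> carrier S"
  shows "submod {y \<in> carrier S. a \<otimes> y \<in> E}"
  using assms by (intro submodI) (auto simp: r_distr m_lcomm submodD[OF assms(1)])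

text \<open>
  This is Nakayama's lemma for the finitely generated \<open>R\<^sub>P\<close>-module \<open>(E + \<Sum> R c)\<^sub>P / E\<^sub>P\<close>, which equals
  \<open>P\<close> times itself. The induction on the number of generators avoids determinants: the first
  generator \<open>c\<close> is added to \<open>E\<close>, so that the other generators lie in the saturation of \<open>E + R c\<close>.
  Substituting them into the relation for \<open>c\<close> gives \<open>(u - q) c \<in> E\<close> with \<open>u \<notin> P\<close> and \<open>q \<in> P\<close>, and
  then \<open>c \<in> E\<close> because \<open>u - q\<close> is again a denominator.
\<close>

lemma nakayama:
  assumes "submod E" "saturated E" "set cs \<subseteq> carrier S"
    and "\<And>c. c \<in> set cs \<Longrightarrow> \<exists>y \<in> Span P cs. c \<ominus> y \<in> E"
  shows "set cs \<subseteq> E"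
  using assms
proof (induction cs arbitrary: E)
  case (Cons c cs)
  note E = submodD[OF Cons.prems(1)]
  have c: "c \<in> carrier S" and cs: "set cs \<subseteq> carrier S" using Cons.prems(3) by auto
  define F where "F = {x. \<exists>e \<in> E. \<exists>r \<in> R. x = e \<oplus> r \<otimes> c}"
  have F: "submod F"
  proof (rule submodI)
    show "F \<subseteq> carrier S" using E(1) c by (auto simp: F_def)
    have "\<zero> = \<zero> \<oplus> \<zero> \<otimes> c" using c by simp
    then show "\<zero> \<in> F" unfolding F_def using E(2) R_closed(1) by blast
  next
    fix x y assume "x \<in> F" "y \<in> F"
    then obtain e r f s where ef: "e \<in> E" "r \<in> R" "f \<in> E" "s \<in> R"
      and xy: "x = e \<oplus> r \<otimes> c" "y = f \<oplus> s \<otimes> c"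
      unfolding F_def by blast
    have "x \<oplus> y = (e \<oplus> f) \<oplus> (r \<oplus> s) \<otimes> c"
      unfolding xy using E(1)[OF ef(1)] E(1)[OF ef(3)] R_carrier[OF ef(2)] R_carrier[OF ef(4)] c
      by algebra
    then show "x \<oplus> y \<in> F"
      unfolding F_def using ef E(3) R_closed(5) by blast
  next
    fix t x assume t: "t \<in> R" and "x \<in> F"
    then obtain e r where er: "e \<in> E" "r \<in> R" and x: "x = e \<oplus> r \<otimes> c"
      unfolding F_def by blast
    have "t \<otimes> x = t \<otimes> e \<oplus> (t \<otimes> r) \<otimes> c"
      unfolding x using E(1)[OF er(1)] R_carrier[OF er(2)] R_carrier[OF t] c by algebra
    then show "t \<otimes> x \<in> F"
      unfolding F_def using er t E(4) R_closed(4) by blast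
  qed
  have EF: "E \<subseteq> F"
  proof
    fix e assume e: "e \<in> E"
    then have "e = e \<oplus> \<zero> \<otimes> c" using E(1) c by simp
    then show "e \<in> F" unfolding F_def using e R_closed(1) by blast
  qed
  have step: "\<exists>p \<in> P. \<exists>v \<in> Span P cs. d \<ominus> (p \<otimes> c \<oplus> v) \<in> E" if d: "d \<in> set (c # cs)" for d
  proof -
    obtain y where "y \<in> Span P (c # cs)" "d \<ominus> y \<in> E" using Cons.prems(4)[OF d] by blast
    then show ?thesis unfolding Span_Cons_iff by blast
  qed
  have P_carrier: "P \<subseteq> carrier S" by auto
  have Span_carrier: "v \<in> carrier S" if "v \<in> Span P cs" for v
    using Span_in_carrier[OF P_carrier cs] that by blast
  have "set cs \<subseteq> sat F"
  proof (rule Cons.IH[OF submod_sat[OF F] saturated_sat cs])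
    fix d assume d: "d \<in> set cs"
    then obtain p v where pv: "p \<in> P" "v \<in> Span P cs" "d \<ominus> (p \<otimes> c \<oplus> v) \<in> E"
      using step[of d] by auto
    have carr: "p \<in> carrier S" "v \<in> carrier S" "d \<in> carrier S"
      using pv(1) Span_carrier[OF pv(2)] cs d by auto
    have "d \<ominus> v = (d \<ominus> (p \<otimes> c \<oplus> v)) \<oplus> p \<otimes> c"
      using c carr by algebra
    then have "d \<ominus> v \<in> F" unfolding F_def using pv(3) P_R[OF pv(1)] by blast
    then show "\<exists>v \<in> Span P cs. d \<ominus> v \<in> sat F"
      using pv(2) subset_sat submodD(1)[OF F] by blast
  qed
  have span: "\<exists>u \<in> N. \<exists>q \<in> P. u \<otimes> y \<ominus> q \<otimes> c \<in> E"
    if "set ds \<subseteq> sat F" "y \<in> Span P ds" for ds y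
    using that
  proof (induction ds arbitrary: y)
    case Nil
    have "\<one> \<otimes> y \<ominus> \<zero> \<otimes> c = \<zero>"
      using Nil c by (simp add: Span_Nil minus_eq)
    then show ?case using N.M_one P_closed(1) E(2) by metis
  next
    case (Cons d ds)
    then obtain p v where pv: "p \<in> P" "v \<in> Span P ds" "y = p \<otimes> d \<oplus> v"
      unfolding Span_Cons_iff by blast
    have "set ds \<subseteq> sat F" using Cons.prems(1) by simp
    then obtain u q where uq: "u \<in> N" "q \<in> P" "u \<otimes> v \<ominus> q \<otimes> c \<in> E"
      using Cons.IH[OF _ pv(2)] by blast
    from Cons.prems obtain w e r where w: "w \<in> N" "e \<in> E" "r \<in> R" "w \<otimes> d = e \<oplus> r \<otimes> c"
      and d: "d \<in> carrier S"
      by (auto simp: sat_def F_def)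
    have v: "v \<in> carrier S"
      using Span_in_carrier[OF P_carrier, of ds] pv(2) Cons.prems(1) sat_carrier by auto
    have carr: "p \<in> carrier S" "u \<in> carrier S" "q \<in> carrier S" "w \<in> carrier S"
        "r \<in> carrier S" "e \<in> carrier S"
      using pv uq w E(1) by auto
    have "(u \<otimes> w) \<otimes> y \<ominus> (u \<otimes> p \<otimes> r \<oplus> w \<otimes> q) \<otimes> c
        = u \<otimes> p \<otimes> (w \<otimes> d) \<oplus> w \<otimes> (u \<otimes> v) \<ominus> (u \<otimes> p \<otimes> r \<oplus> w \<otimes> q) \<otimes> c"
      unfolding pv(3) using carr v d c by algebra
    also have "\<dots> = u \<otimes> p \<otimes> e \<oplus> w \<otimes> (u \<otimes> v \<ominus> q \<otimes> c)"
      unfolding w(4) using carr v c by algebra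
    also have "\<dots> \<in> E"
      using uq w pv by (simp add: E)
    finally have "(u \<otimes> w) \<otimes> y \<ominus> (u \<otimes> p \<otimes> r \<oplus> w \<otimes> q) \<otimes> c \<in> E" .
    moreover have "u \<otimes> p \<otimes> r \<oplus> w \<otimes> q \<in> P" using pv uq w by simp
    ultimately show ?case using uq(1) w(1) N_mult by blast
  qed
  have "c \<in> E"
  proof -
    obtain p v where pv: "p \<in> P" "v \<in> Span P cs" "c \<ominus> (p \<otimes> c \<oplus> v) \<in> E"
      using step[of c] by auto
    obtain u q where uq: "u \<in> N" "q \<in> P" "u \<otimes> v \<ominus> q \<otimes> c \<in> E"
      using span[OF \<open>set cs \<subseteq> sat F\<close> pv(2)] by blast
    have carr: "p \<in> carrier S" "u \<in> carrier S" "q \<in> carrier S" "v \<in> carrier S"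
      using pv uq Span_carrier by auto
    have "(u \<ominus> (u \<otimes> p \<oplus> q)) \<otimes> c = u \<otimes> (c \<ominus> (p \<otimes> c \<oplus> v)) \<oplus> (u \<otimes> v \<ominus> q \<otimes> c)"
      using carr c by algebra
    also have "\<dots> \<in> E" using pv uq by (simp add: E)
    finally have "(u \<ominus> (u \<otimes> p \<oplus> q)) \<otimes> c \<in> E" .
    moreover have "u \<otimes> p \<oplus> q \<in> P" using pv uq by simp
    ultimately show "c \<in> E"
      using saturatedD[OF Cons.prems(2) N_minus_P[OF uq(1)] c] by blast
  qed
  have "F \<subseteq> E"
    using \<open>c \<in> E\<close> E(3,4) by (auto simp: F_def)
  then have "set cs \<subseteq> E"
    by (rule order_trans[OF \<open>set cs \<subseteq> sat F\<close> sat_subset[OF _ Cons.prems(2)]])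
  with \<open>c \<in> E\<close> show ?case by simp
qed simp

lemma mult_Span:
  assumes "a \<in> P" "set cs \<subseteq> carrier S"
  shows "x \<in> Span R cs \<Longrightarrow> a \<otimes> x \<in> Span P cs"
  using assms(2)
proof (induction cs arbitrary: x)
  case (Cons c cs)
  then obtain k v where kv: "k \<in> R" "v \<in> Span R cs" "x = k \<otimes> c \<oplus> v"
    unfolding Span_Cons_iff by blast
  have "a \<otimes> x = (a \<otimes> k) \<otimes> c \<oplus> a \<otimes> v"
    unfolding kv using kv assms Cons.prems submodD(1)[OF submod_Span kv(2)]
    by (simp add: r_distr m_assoc)
  moreover have "a \<otimes> v \<in> Span P cs" using Cons kv by simp
  moreover have "a \<otimes> k \<in> P" using kv assms by simp
  ultimately show ?case unfolding Span_Cons_iff by blast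
qed (use assms in \<open>simp add: Span_Nil\<close>)

text \<open>
  Seminormality passes to the localization: \<open>u v b\<close> has its square and cube in \<open>R\<close> when \<open>u b\<^sup>2\<close> and
  \<open>v b\<^sup>3\<close> are in \<open>R\<close>.
\<close>

lemma seminormal_sat:
  assumes sn: "seminormal_extension S R" and b: "b \<in> carrier S"
    and "b \<otimes> b \<in> sat R" "b \<otimes> b \<otimes> b \<in> sat R"
  shows "b \<in> sat R"
proof -
  obtain u v where uv: "u \<in> N" "u \<otimes> (b \<otimes> b) \<in> R" "v \<in> N" "v \<otimes> (b \<otimes> b \<otimes> b) \<in> R"
    using assms by (auto simp: sat_def)
  then have c: "u \<in> carrier S" "v \<in> carrier S" by auto
  define w where "w = (u \<otimes> v) \<otimes> b"
  have w: "w \<in> carrier S" using c b by (simp add: w_def)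
  have "w [^] (2::nat) = (u \<otimes> v \<otimes> v) \<otimes> (u \<otimes> (b \<otimes> b))"
    using c b by (simp add: w_def numeral_2_eq_2 m_ac)
  moreover have "w [^] (3::nat) = (u \<otimes> u \<otimes> u \<otimes> v \<otimes> v) \<otimes> (v \<otimes> (b \<otimes> b \<otimes> b))"
    using c b by (simp add: w_def numeral_3_eq_3 m_ac)
  ultimately have "w [^] (2::nat) \<in> R" "w [^] (3::nat) \<in> R" using uv by simp_all
  then have "w \<in> R" using sn w unfolding seminormal_extension_def by blast
  then show ?thesis
    using uv b by (intro satI[of b "u \<otimes> v"]) (auto simp: w_def)
qed

text \<open>
  The sets \<open>R + a\<^sup>n Y\<close> are subalgebras, since \<open>a\<^sup>n Y\<close> is closed under multiplication, and they decrease
  with \<open>n\<close>. By FCP there is an \<open>m\<close> with \<open>a\<^sup>m Y \<subseteq> R + a (a\<^sup>m Y)\<close>, to which Nakayama's lemma applies.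
\<close>

lemma eventual_power_in_sat:
  assumes fcp: "FCP_extension S R" and Y: "Y \<in> subalgebras S R"
    and cs: "set cs \<subseteq> Y" "Y \<subseteq> Span R cs" and a: "a \<in> P"
  shows "\<exists>m. \<forall>y \<in> Y. a [^] (m :: nat) \<otimes> y \<in> sat R"
proof -
  have Ys: "subring Y S" "R \<subseteq> Y" using Y by (auto simp: subalgebras_def)
  note YE = subringE[OF Ys(1)]
  have a_R: "a \<in> R" and a_S: "a \<in> carrier S" and a_Y: "a \<in> Y"
    using a Ys(2) by auto
  have pow: "a [^] n \<in> R" "a [^] n \<in> carrier S" "a [^] n \<in> Y" for n :: nat
    using R_pow[OF a_R] Ys(2) by auto
  have Y_S: "y \<in> carrier S" if "y \<in> Y" for y using that YE(1) by blast
  define B where "B n = {x. \<exists>r \<in> R. \<exists>y \<in> Y. x = r \<oplus> a [^] (n :: nat) \<otimes> y}" for n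
  have B_sub: "B n \<in> subalgebras S R" for n
  proof -
    have RB: "R \<subseteq> B n"
    proof
      fix r assume r: "r \<in> R"
      then have "r = r \<oplus> a [^] n \<otimes> \<zero>" using pow by simp
      then show "r \<in> B n" unfolding B_def using r YE(2) by blast
    qed
    moreover have "subring (B n) S"
    proof (rule subringI)
      show "B n \<subseteq> carrier S" using Y_S pow by (auto simp: B_def)
      show "\<one> \<in> B n" using RB by auto
    next
      fix x assume "x \<in> B n"
      then obtain r y where ry: "r \<in> R" "y \<in> Y" "x = r \<oplus> a [^] n \<otimes> y"
        unfolding B_def by blast
      have "\<ominus> x = (\<ominus> r) \<oplus> a [^] n \<otimes> (\<ominus> y)"
        unfolding ry using ry(1,2) Y_S pow by (simp add: minus_add r_minus)
      then show "\<ominus> x \<in> B n" unfolding B_def using ry R_closed(3) YE(5) by blast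
    next
      fix x x' assume "x \<in> B n" "x' \<in> B n"
      then obtain r y r' y' where ry: "r \<in> R" "y \<in> Y" "r' \<in> R" "y' \<in> Y"
        and x: "x = r \<oplus> a [^] n \<otimes> y" "x' = r' \<oplus> a [^] n \<otimes> y'"
        unfolding B_def by blast
      note carr = pow(2)[of n] R_carrier[OF ry(1)] R_carrier[OF ry(3)] Y_S[OF ry(2)] Y_S[OF ry(4)]
      have "x \<oplus> x' = (r \<oplus> r') \<oplus> a [^] n \<otimes> (y \<oplus> y')"
        unfolding x using carr by algebra
      then show "x \<oplus> x' \<in> B n" unfolding B_def using ry R_closed(5) YE(7) by blast
      have "x \<otimes> x' = (r \<otimes> r') \<oplus> a [^] n \<otimes> (r \<otimes> y' \<oplus> r' \<otimes> y \<oplus> a [^] n \<otimes> (y \<otimes> y'))"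
        unfolding x using carr by algebra
      moreover have "r \<otimes> y' \<oplus> r' \<otimes> y \<oplus> a [^] n \<otimes> (y \<otimes> y') \<in> Y"
        using ry Ys(2) pow(3) by (auto intro!: YE(6,7))
      ultimately show "x \<otimes> x' \<in> B n" unfolding B_def using ry R_closed(4) by blast
    qed
    ultimately show ?thesis by (simp add: subalgebras_def)
  qed
  have B_Suc: "B (Suc n) \<subseteq> B n" for n
  proof
    fix x assume "x \<in> B (Suc n)"
    then obtain r y where ry: "r \<in> R" "y \<in> Y" "x = r \<oplus> a [^] Suc n \<otimes> y"
      unfolding B_def by blast
    have "x = r \<oplus> a [^] n \<otimes> (a \<otimes> y)"
      unfolding ry using ry(1,2) Y_S pow a_S by (simp add: m_assoc)
    then show "x \<in> B n" unfolding B_def using ry YE(6)[OF a_Y] by blast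
  qed
  have anti: "B n \<subseteq> B m" if "m \<le> n" for m n
    using lift_Suc_antimono_le[of B, OF B_Suc that] .
  have "subset.chain (subalgebras S R) (range B)"
    unfolding subset_chain_def
  proof (intro conjI ballI)
    show "range B \<subseteq> subalgebras S R" using B_sub by blast
    fix U V assume "U \<in> range B" "V \<in> range B"
    then obtain k l where "U = B k" "V = B l" by blast
    then show "U \<subseteq> V \<or> V \<subseteq> U" using anti[of k l] anti[of l k] linear[of k l] by auto
  qed
  then have "finite (range B)" using fcp unfolding FCP_extension_def by blast
  then have "\<not> inj B" using finite_imageD[of B UNIV] by auto
  then obtain m n where "m < n" "B m = B n"
    unfolding inj_def by (metis linorder_neqE_nat)
  then have stab: "B m \<subseteq> B (Suc m)" using anti[of "Suc m" n] by simp
  \<comment> \<open>Dividing by \<open>a\<^sup>m\<close> allows Nakayama's lemma to be used with the generators of \<open>Y\<close> itself.\<close>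
  define E where "E = {y \<in> carrier S. a [^] m \<otimes> y \<in> sat R}"
  have E: "submod E"
    unfolding E_def by (intro submod_colon submod_sat submod_R pow)
  have "saturated E"
    unfolding saturated_def
  proof (intro ballI impI)
    fix u x assume u: "u \<in> N" and x: "x \<in> carrier S" and "u \<otimes> x \<in> E"
    then have "u \<otimes> (a [^] m \<otimes> x) \<in> sat R" using pow by (simp add: E_def m_lcomm)
    then show "x \<in> E"
      using saturatedD[OF saturated_sat u] x pow by (simp add: E_def)
  qed
  have csS: "set cs \<subseteq> carrier S" using cs(1) YE(1) by blast
  have "set cs \<subseteq> E"
  proof (rule nakayama[OF E \<open>saturated E\<close> csS])
    fix c assume "c \<in> set cs"
    then have c: "c \<in> Y" using cs by blast
    have "a [^] m \<otimes> c = \<zero> \<oplus> a [^] m \<otimes> c" using Y_S[OF c] pow by simp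
    then have "a [^] m \<otimes> c \<in> B m" unfolding B_def using c R_closed(1) by blast
    then obtain r z where rz: "r \<in> R" "z \<in> Y" "a [^] m \<otimes> c = r \<oplus> a [^] Suc m \<otimes> z"
      using stab unfolding B_def by blast
    have "a [^] m \<otimes> (c \<ominus> a \<otimes> z) = a [^] m \<otimes> c \<ominus> a [^] Suc m \<otimes> z"
      using Y_S[OF c] Y_S[OF rz(2)] a_S pow(2)[of m] by (simp add: minus_eq r_distr r_minus m_assoc)
    also have "\<dots> = r"
      unfolding rz(3) using rz(1) Y_S[OF rz(2)] a_S pow(2)[of "Suc m"]
      by (simp add: minus_eq a_assoc r_neg del: nat_pow_Suc)
    finally have "c \<ominus> a \<otimes> z \<in> E"
      using rz Y_S[OF c] Y_S[OF rz(2)] a_S subset_sat[OF subringE(1)[OF subring_R]] by (auto simp: E_def)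
    moreover have "a \<otimes> z \<in> Span P cs"
      using mult_Span[OF a csS] cs(2) rz(2) by blast
    ultimately show "\<exists>y \<in> Span P cs. c \<ominus> y \<in> E" by blast
  qed
  then have "Y \<subseteq> E" using Span_subset[OF E] cs(2) by blast
  then show ?thesis by (auto simp: E_def)
qed

text \<open>
  The localized maximal ideal \<open>P R\<^sub>P\<close> lies in the conductor of \<open>R\<^sub>P\<close> in \<open>S\<^sub>P\<close>. In a finite subalgebra \<open>Y\<close>
  that contains \<open>x\<close>, some power of \<open>a\<close> moves \<open>Y\<close> into \<open>R\<^sub>P\<close>, and the exponent can be lowered as long
  as it exceeds 1: the square and cube of \<open>b = a\<^sup>k\<^sup>+\<^sup>1 y\<close> are multiples of \<open>a\<^sup>k\<^sup>+\<^sup>2\<close> by elements of \<open>Y\<close>.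
\<close>

lemma P_conducts:
  assumes "FCP_extension S R" "integral_extension S R" and sn: "seminormal_extension S R"
    and a: "a \<in> P" and x: "x \<in> carrier S"
  shows "a \<otimes> x \<in> sat R"
proof -
  obtain Y cs where Y: "Y \<in> subalgebras S R" "x \<in> Y" "set cs \<subseteq> Y" "Y \<subseteq> Span R cs"
    using integral_imp_finite_subalgebra[OF assms(2) x] by blast
  have Ys: "subring Y S" using Y by (auto simp: subalgebras_def)
  have Y_S: "y \<in> carrier S" if "y \<in> Y" for y using that subringE(1)[OF Ys] by blast
  have a_S: "a \<in> carrier S" and a_Y: "a \<in> Y" using a Y(1) by (auto simp: subalgebras_def)
  obtain m where m: "\<forall>y \<in> Y. a [^] (m :: nat) \<otimes> y \<in> sat R"
    using eventual_power_in_sat[OF assms(1) Y(1,3,4) a] by blast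
  have "a [^] (k :: nat) \<in> Y" for k
    by (induction k) (use subringE(3,6)[OF Ys] a_Y in auto)
  then have Y_pow: "a [^] (k :: nat) \<otimes> y \<in> Y" if "y \<in> Y" for k y
    using that by (intro subringE(6)[OF Ys])
  have "\<forall>y \<in> Y. a [^] Suc k \<otimes> y \<in> sat R" if "\<forall>y \<in> Y. a [^] Suc (Suc k) \<otimes> y \<in> sat R" for k
  proof
    fix y assume y: "y \<in> Y"
    define b t where "b = a [^] Suc k \<otimes> y" and "t = a [^] k"
    have b: "b = (t \<otimes> a) \<otimes> y" and t: "t \<in> carrier S" and t2: "a [^] Suc (Suc k) = t \<otimes> a \<otimes> a"
      using a_S by (simp_all add: b_def t_def)
    have "y \<otimes> y \<in> Y" "y \<otimes> y \<otimes> y \<in> Y" using y subringE(6)[OF Ys] by auto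
    then have "a [^] k \<otimes> (y \<otimes> y) \<in> Y" "a [^] k \<otimes> (a [^] Suc k \<otimes> (y \<otimes> y \<otimes> y)) \<in> Y"
      using Y_pow by blast+
    then have *: "(t \<otimes> a \<otimes> a) \<otimes> (t \<otimes> (y \<otimes> y)) \<in> sat R"
        "(t \<otimes> a \<otimes> a) \<otimes> (t \<otimes> (t \<otimes> a \<otimes> (y \<otimes> y \<otimes> y))) \<in> sat R"
      using that unfolding t2 by (simp_all add: t_def)
    have "b \<otimes> b = (t \<otimes> a \<otimes> a) \<otimes> (t \<otimes> (y \<otimes> y))"
      unfolding b using a_S Y_S[OF y] t by algebra
    moreover have "b \<otimes> b \<otimes> b = (t \<otimes> a \<otimes> a) \<otimes> (t \<otimes> (t \<otimes> a \<otimes> (y \<otimes> y \<otimes> y)))"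
      unfolding b using a_S Y_S[OF y] t by algebra
    ultimately have bb: "b \<otimes> b \<in> sat R" "b \<otimes> b \<otimes> b \<in> sat R" using * by simp_all
    have "b \<in> carrier S" using a_S Y_S[OF y] by (simp add: b_def)
    then have "b \<in> sat R" using bb by (rule seminormal_sat[OF sn])
    then show "a [^] Suc k \<otimes> y \<in> sat R" by (simp only: b_def)
  qed
  then have "\<forall>y \<in> Y. a [^] Suc 0 \<otimes> y \<in> sat R" if "\<forall>y \<in> Y. a [^] Suc k \<otimes> y \<in> sat R" for k
    using that by (induction k) blast+
  moreover have "\<forall>y \<in> Y. a [^] Suc m \<otimes> y \<in> sat R"
    using m subringE(6)[OF Ys a_Y] a_S Y_S by (auto simp: m_assoc)
  ultimately show ?thesis using Y(2) a_S by auto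
qed

text \<open>
  The conductor property puts \<open>a x\<close> into \<open>R\<^sub>P\<close> for \<open>a \<in> P\<close>. It lies in \<open>P R\<^sub>P\<close> because its square
  \<open>a (a x\<^sup>2)\<close> is a multiple of \<open>a\<close> by an element of \<open>R\<^sub>P\<close> and \<open>P\<close> is prime.
\<close>

lemma ideal_sat_P:
  assumes con: "\<And>a x. \<lbrakk>a \<in> P; x \<in> carrier S\<rbrakk> \<Longrightarrow> a \<otimes> x \<in> sat R"
  shows "ideal (sat P) S"
proof -
  have submod_P: "submod P" by (intro submodI) auto
  note sm = submod_sat[OF submod_P]
  have mult: "x \<otimes> y \<in> sat P" if "y \<in> sat P" and x: "x \<in> carrier S" for x y
  proof -
    from that obtain v where v: "v \<in> N" "v \<otimes> y \<in> P" and y: "y \<in> carrier S" by (auto simp: sat_def)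
    define a where "a = v \<otimes> y"
    have a: "a \<in> P" "a \<in> carrier S" using v by (auto simp: a_def)
    obtain u where u: "u \<in> N" "u \<otimes> (a \<otimes> x) \<in> R"
      using con[OF a(1) x] by (auto simp: sat_def)
    obtain w where w: "w \<in> N" "w \<otimes> (a \<otimes> (x \<otimes> x)) \<in> R"
      using con[OF a(1), of "x \<otimes> x"] x by (auto simp: sat_def)
    have carr: "u \<in> carrier S" "v \<in> carrier S" "w \<in> carrier S" using u v w by auto
    have "(w \<otimes> (u \<otimes> (a \<otimes> x))) \<otimes> (u \<otimes> (a \<otimes> x)) = (w \<otimes> (a \<otimes> (x \<otimes> x))) \<otimes> (u \<otimes> u \<otimes> a)"
      using carr x a(2) by (simp add: m_ac)
    also have "\<dots> \<in> P" using w u a by simp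
    finally have "w \<otimes> (u \<otimes> (a \<otimes> x)) \<in> P \<or> u \<otimes> (a \<otimes> x) \<in> P"
      by (rule P_prime[rotated 2]) (use u w in simp_all)
    moreover have "u \<otimes> (a \<otimes> x) \<in> P" if "w \<otimes> (u \<otimes> (a \<otimes> x)) \<in> P"
      using P_prime[OF N_R[OF w(1)] u(2) that] N_not_P[OF w(1)] by blast
    ultimately have "u \<otimes> (a \<otimes> x) \<in> P" by blast
    moreover have "u \<otimes> (a \<otimes> x) = (u \<otimes> v) \<otimes> (x \<otimes> y)"
      using carr x y by (simp add: a_def m_ac)
    ultimately show ?thesis
      using x y u v by (intro satI[of _ "u \<otimes> v"]) auto
  qed
  show ?thesis
  proof (rule idealI[OF ring_axioms])
    show "subgroup (sat P) (add_monoid S)"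
      by (rule add.subgroupI)
        (use sm submodD(2,3)[OF sm] submod_uminus[OF sm] sat_carrier in auto)
    show "x \<otimes> a \<in> sat P" if "a \<in> sat P" "x \<in> carrier S" for a x using mult that by blast
    then show "a \<otimes> x \<in> sat P" if "a \<in> sat P" "x \<in> carrier S" for a x
      using that sat_carrier by (metis m_comm)
  qed
qed

end

section \<open>Residue fields at the primes of a fiber\<close>

context ring_extension
begin

lemma cring_R: "cring (S\<lparr>carrier := R\<rparr>)"
  using subcring_iff[OF subringE(1)[OF subring_R]] subcringI'[OF subring_R] by blast

text \<open>
  As \<open>loc_map\<close> takes the image of a class under a relation, the union of the classes so obtained has
  to be identified with a single class.
\<close>

lemma loc_map_fraction:
  assumes M: "multiplicative_subset S M" and NM: "N \<subseteq> M" and r: "r \<in> R" and s: "s \<in> N" and NR: "N \<subseteq> R"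
    and N: "multiplicative_subset (S\<lparr>carrier := R\<rparr>) N"
  shows "loc_map S M (fraction (S\<lparr>carrier := R\<rparr>) N r s) = fraction S M r s"
proof -
  interpret M: multiplicative_subset S M by (rule M)
  interpret N: multiplicative_subset "S\<lparr>carrier := R\<rparr>" N by (rule N)
  have sub: "frac_rel (S\<lparr>carrier := R\<rparr>) N \<subseteq> frac_rel S M"
    using NM unfolding frac_rel_def by fastforce
  have tr: "trans (frac_rel S M)"
    using M.equiv_frac_rel by (simp add: equiv_def)
  show ?thesis
  proof
    show "loc_map S M (fraction (S\<lparr>carrier := R\<rparr>) N r s) \<subseteq> fraction S M r s"
      unfolding loc_map_def fraction_def using sub tr by (auto dest: transD)
    show "fraction S M r s \<subseteq> loc_map S M (fraction (S\<lparr>carrier := R\<rparr>) N r s)"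
      unfolding loc_map_def using N.fraction_self[of r s] r s
      by (auto simp: M.fraction_mem_iff)
  qed
qed

end

context ring_extension_prime
begin

lemma multiplicative_N: "multiplicative_subset (S\<lparr>carrier := R\<rparr>) N"
  by (intro multiplicative_subset.intro multiplicative_subset_axioms.intro cring_R)
    (use N.M_one N_R in auto)

definition fiber :: "'a set set" where
  "fiber = {Q. primeideal Q S \<and> Q \<inter> R = P}"

lemma fiberD:
  assumes "Q \<in> fiber"
  shows "primeideal Q S" and "ideal Q S" and "Q \<inter> R = P"
    and "p \<in> P \<Longrightarrow> p \<in> Q" and "\<lbrakk>r \<in> R; r \<in> Q\<rbrakk> \<Longrightarrow> r \<in> P"
    and "u \<in> N \<Longrightarrow> u \<notin> Q"
    and "\<lbrakk>x \<in> carrier S; y \<in> carrier S; x \<otimes> y \<in> Q\<rbrakk> \<Longrightarrow> x \<in> Q \<or> y \<in> Q"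
  using assms N_not_P N_R primeideal.axioms(1) primeideal.I_prime[of Q S x y]
  by (auto simp: fiber_def)

text \<open>
  Surjectivity of the residual map at \<open>Q\<close>, without localizations: the class of \<open>x\<close> in the residue
  field of \<open>Q\<close> is the class of a fraction \<open>r / u\<close> from \<open>R\<^sub>P\<close>, and \<open>x - r / u \<in> Q S\<^sub>Q\<close> means
  \<open>u x - r \<in> Q\<close>.
\<close>

lemma residue_fraction:
  assumes inf: "infra_integral_extension S R" and Q: "Q \<in> fiber" and x: "x \<in> carrier S"
  shows "\<exists>u \<in> N. \<exists>r \<in> R. u \<otimes> x \<ominus> r \<in> Q"
proof -
  interpret Q: primeideal Q S by (rule fiberD[OF Q])
  define M where "M = carrier S - Q"
  define A where "A = S\<lparr>carrier := R\<rparr>"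
  have one_Q: "\<one> \<notin> Q" using Q.one_imp_carrier Q.I_notcarr by blast
  have M: "multiplicative_subset S M"
    using one_Q Q.I_prime is_cring
    by (intro multiplicative_subset.intro multiplicative_subset_axioms.intro) (auto simp: M_def)
  interpret M: multiplicative_subset S M by (rule M)
  interpret NA: multiplicative_subset A N using multiplicative_N by (simp add: A_def)
  interpret LS: cring "localization S M" by (rule M.cring_Loc)
  interpret LA: cring "localization A N" by (rule NA.cring_Loc)
  have NM: "N \<subseteq> M" using fiberD(6)[OF Q] by (auto simp: M_def)
  have QS: "Q \<subseteq> carrier S" using Q.a_subset .
  define J where "J = loc_max_ideal S Q"
  define I where "I = loc_max_ideal A P"
  have carrier_A: "carrier A - P = N" by (simp add: A_def N_def)
  have J_eq: "J = Idl\<^bsub>localization S M\<^esub> ((\<lambda>a. fraction S M a \<one>) ` Q)"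
    by (simp add: J_def loc_max_ideal_def M_def)
  have J: "ideal J (localization S M)"
    unfolding J_eq by (rule LS.genideal_ideal) (use QS M.M_one in auto)
  have I: "ideal I (localization A N)"
    unfolding I_def loc_max_ideal_def carrier_A
  proof (rule LA.genideal_ideal)
    have "P \<subseteq> carrier A" by (auto simp: A_def)
    then show "(\<lambda>a. fraction A N a \<one>\<^bsub>A\<^esub>) ` P \<subseteq> carrier (localization A N)"
      using NA.M_one by blast
  qed
  interpret J: ideal J "localization S M" by (rule J)
  interpret I: ideal I "localization A N" by (rule I)
  \<comment> \<open>The fractions \<open>a / t\<close> with \<open>a \<in> Q\<close> form an ideal that contains the generators of \<open>J\<close>.\<close>
  have J_sub: "\<exists>a \<in> Q. \<exists>t \<in> M. j = fraction S M a t" if "j \<in> J" for j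
  proof -
    define J0 where "J0 = {fraction S M a t | a t. a \<in> Q \<and> t \<in> M}"
    have mult: "y \<otimes>\<^bsub>localization S M\<^esub> j \<in> J0" if j: "j \<in> J0" and y: "y \<in> carrier (localization S M)" for y j
    proof -
      obtain a t b s where at: "a \<in> Q" "t \<in> M" "j = fraction S M a t"
        and bs: "b \<in> carrier S" "s \<in> M" "y = fraction S M b s"
        using j y unfolding J0_def M.carrier_Loc by blast
      have "y \<otimes>\<^bsub>localization S M\<^esub> j = fraction S M (b \<otimes> a) (s \<otimes> t)"
        using at bs QS by (simp add: M.mult_fraction subsetD)
      moreover have "b \<otimes> a \<in> Q" using at bs by (simp add: Q.I_l_closed)
      ultimately show ?thesis using M.M_mult[OF bs(2) at(2)] unfolding J0_def by blast
    qed
    have J0_carrier: "J0 \<subseteq> carrier (localization S M)"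
      using QS by (auto simp: J0_def)
    have "ideal J0 (localization S M)"
    proof (rule idealI[OF LS.ring_axioms])
      show "subgroup J0 (add_monoid (localization S M))"
      proof (rule LS.add.subgroupI)
        show "J0 \<subseteq> carrier (localization S M)" by (rule J0_carrier)
        have "fraction S M \<zero> \<one> \<in> J0" using Q.zero_closed M.M_one unfolding J0_def by blast
        then show "J0 \<noteq> {}" by blast
      next
        fix j assume "j \<in> J0"
        then obtain a t where at: "a \<in> Q" "t \<in> M" "j = fraction S M a t"
          unfolding J0_def by blast
        then have "\<ominus>\<^bsub>localization S M\<^esub> j = fraction S M (\<ominus> a) t"
          using QS by (simp add: M.minus_fraction subsetD)
        then show "\<ominus>\<^bsub>localization S M\<^esub> j \<in> J0"
          unfolding J0_def using at Q.a_inv_closed by blast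
      next
        fix j k assume "j \<in> J0" "k \<in> J0"
        then obtain a t b s where at: "a \<in> Q" "t \<in> M" "j = fraction S M a t"
          and bs: "b \<in> Q" "s \<in> M" "k = fraction S M b s"
          unfolding J0_def by blast
        have "j \<oplus>\<^bsub>localization S M\<^esub> k = fraction S M (a \<otimes> s \<oplus> b \<otimes> t) (t \<otimes> s)"
          using at bs QS by (simp add: M.add_fraction subsetD)
        moreover have "a \<otimes> s \<oplus> b \<otimes> t \<in> Q"
          using at bs by (intro Q.a_closed Q.I_r_closed) auto
        ultimately show "j \<oplus>\<^bsub>localization S M\<^esub> k \<in> J0"
          using M.M_mult[OF at(2) bs(2)] unfolding J0_def by blast
      qed
      show "y \<otimes>\<^bsub>localization S M\<^esub> j \<in> J0" if "j \<in> J0" "y \<in> carrier (localization S M)" for j y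
        using mult that .
      then show "j \<otimes>\<^bsub>localization S M\<^esub> y \<in> J0" if "j \<in> J0" "y \<in> carrier (localization S M)" for j y
        using that LS.m_comm[OF subsetD[OF J0_carrier that(1)] that(2)] by simp
    qed
    moreover have "(\<lambda>a. fraction S M a \<one>) ` Q \<subseteq> J0"
      using M.M_one by (auto simp: J0_def)
    ultimately have "J \<subseteq> J0" unfolding J_eq by (rule LS.genideal_minimal)
    then show ?thesis using \<open>j \<in> J\<close> unfolding J0_def by blast
  qed
  have fx: "fraction S M x \<one> \<in> carrier (localization S M)" by (rule M.fraction_closed[OF x M.M_one])
  have "residual_map S Q \<in> ring_iso (residue_field A P) (residue_field S Q)"
    using inf fiberD(1,3)[OF Q] by (auto simp: infra_integral_extension_def ring_spec_def A_def)
  then have surj: "residual_map S Q ` carrier (residue_field A P) = carrier (residue_field S Q)"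
    by (simp add: ring_iso_def bij_betw_def)
  have carrier_k: "carrier (residue_field S Q) = a_rcosets\<^bsub>localization S M\<^esub> J"
    by (simp add: residue_field_def FactRing_def J_def M_def)
  have carrier_l: "carrier (residue_field A P) = a_rcosets\<^bsub>localization A N\<^esub> I"
    by (simp add: residue_field_def FactRing_def I_def carrier_A)
  have "J +>\<^bsub>localization S M\<^esub> fraction S M x \<one> \<in> residual_map S Q ` carrier (residue_field A P)"
    unfolding surj carrier_k using fx by (auto simp: A_RCOSETS_def')
  then obtain C where "C \<in> carrier (residue_field A P)"
    and C: "residual_map S Q C = J +>\<^bsub>localization S M\<^esub> fraction S M x \<one>"
    by blast
  then obtain z where z: "z \<in> carrier (localization A N)" "C = I +>\<^bsub>localization A N\<^esub> z"
    unfolding carrier_l A_RCOSETS_def' by blast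
  have "z \<in> C" unfolding z(2) by (rule I.a_rcos_self[OF z(1)])
  obtain r s where rs: "r \<in> R" "s \<in> N" "z = fraction A N r s"
    using z(1) unfolding NA.carrier_Loc by (auto simp: A_def)
  have s: "s \<in> M" "s \<in> carrier S" using rs NM by auto
  have frs: "fraction S M r s \<in> carrier (localization S M)"
    by (rule M.fraction_closed[OF R_carrier[OF rs(1)] s(1)])
  have NR: "N \<subseteq> R" by auto
  have "loc_map S M z = fraction S M r s"
    unfolding rs(3) A_def by (rule loc_map_fraction[OF M NM rs(1,2) NR multiplicative_N])
  then have "J +>\<^bsub>localization S M\<^esub> fraction S M r s \<subseteq> residual_map S Q C"
    unfolding residual_map_def M_def[symmetric] J_def[symmetric] using \<open>z \<in> C\<close> by auto
  then have "fraction S M r s \<in> J +>\<^bsub>localization S M\<^esub> fraction S M x \<one>"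
    using J.a_rcos_self[OF frs] C by auto
  then obtain j where "j \<in> J" "fraction S M r s = j \<oplus>\<^bsub>localization S M\<^esub> fraction S M x \<one>"
    unfolding a_r_coset_def' by blast
  then obtain a t where at: "a \<in> Q" "t \<in> M"
    and eq: "fraction S M r s = fraction S M a t \<oplus>\<^bsub>localization S M\<^esub> fraction S M x \<one>"
    using J_sub by blast
  have carr: "a \<in> carrier S" "t \<in> carrier S" "r \<in> carrier S" using at QS rs by auto
  have "fraction S M r s = fraction S M (a \<oplus> x \<otimes> t) t"
    unfolding eq using at carr x M.M_one by (simp add: M.add_fraction)
  then have "\<exists>v \<in> M. v \<otimes> (r \<otimes> t) = v \<otimes> ((a \<oplus> x \<otimes> t) \<otimes> s)"
    using carr at(2) s x by (simp add: M.fraction_eq_iff)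
  then obtain v where v: "v \<in> M" "v \<otimes> (r \<otimes> t) = v \<otimes> ((a \<oplus> x \<otimes> t) \<otimes> s)" by blast
  have vc: "v \<in> carrier S" using v by auto
  have "(v \<otimes> t) \<otimes> (s \<otimes> x \<ominus> r) = v \<otimes> ((a \<oplus> x \<otimes> t) \<otimes> s) \<ominus> v \<otimes> s \<otimes> a \<ominus> v \<otimes> (r \<otimes> t)"
    using vc carr s x by algebra
  also have "\<dots> = \<ominus> (v \<otimes> s \<otimes> a)"
    unfolding v(2)[symmetric] using vc carr s x by algebra
  also have "\<dots> \<in> Q" using at vc s by (intro Q.a_inv_closed Q.I_l_closed) auto
  finally have "v \<otimes> t \<in> Q \<or> s \<otimes> x \<ominus> r \<in> Q"
    using carr vc s x by (intro Q.I_prime) auto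
  moreover have "v \<otimes> t \<notin> Q" using M.M_mult[OF v(1) at(2)] by (simp add: M_def)
  ultimately show ?thesis using rs(1,2) by blast
qed

end

section \<open>Three primes in a fiber\<close>

context ring_extension_prime
begin

text \<open>
  The elements of \<open>S\<close> that are congruent to an element of \<open>R\<^sub>P\<close> modulo \<open>J\<close> after localization at \<open>P\<close>.
  For \<open>J = Q \<inter> Q'\<close> with two primes over \<open>P\<close> these are the elements that have the same value in the
  residue field of \<open>P\<close> at \<open>Q\<close> and at \<open>Q'\<close>.
\<close>

definition constant_mod :: "'a set \<Rightarrow> 'a set" where
  "constant_mod J = {x \<in> carrier S. \<exists>u \<in> N. \<exists>r \<in> R. u \<otimes> x \<ominus> r \<in> J}"

lemma constant_modI:
  "\<lbrakk>x \<in> carrier S; u \<in> N; r \<in> R; u \<otimes> x \<ominus> r \<in> J\<rbrakk> \<Longrightarrow> x \<in> constant_mod J"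
  unfolding constant_mod_def by blast

lemma constant_modE:
  assumes "x \<in> constant_mod J"
  obtains u r where "x \<in> carrier S" "u \<in> N" "r \<in> R" "u \<otimes> x \<ominus> r \<in> J"
  using assms unfolding constant_mod_def by blast

lemma ideal_subset_constant_mod:
  assumes "ideal J S" "x \<in> J"
  shows "x \<in> constant_mod J"
proof -
  interpret J: ideal J S by fact
  have "\<one> \<otimes> x \<ominus> \<zero> = x" using J.Icarr[OF assms(2)] by (simp add: minus_eq)
  then show ?thesis
    using assms N.M_one J.Icarr[OF assms(2)] by (intro constant_modI[of x \<one> \<zero>]) auto
qed

lemma constant_mod_subalgebra:
  assumes "ideal J S"
  shows "constant_mod J \<in> subalgebras S R"
proof -
  interpret J: ideal J S by fact
  have RC: "R \<subseteq> constant_mod J"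
  proof
    fix r assume r: "r \<in> R"
    then have "\<one> \<otimes> r \<ominus> r \<in> J" using J.zero_closed by (simp add: minus_eq r_neg)
    then show "r \<in> constant_mod J"
      by (rule constant_modI[OF R_carrier[OF r] N.M_one r])
  qed
  moreover have "subring (constant_mod J) S"
  proof (rule subringI)
    show "constant_mod J \<subseteq> carrier S" by (auto simp: constant_mod_def)
    show "\<one> \<in> constant_mod J" using RC R_closed(2) by blast
  next
    fix x assume "x \<in> constant_mod J"
    then obtain u r where x: "x \<in> carrier S" "u \<in> N" "r \<in> R" "u \<otimes> x \<ominus> r \<in> J"
      by (rule constant_modE)
    have "u \<otimes> (\<ominus> x) \<ominus> (\<ominus> r) = \<ominus> (u \<otimes> x \<ominus> r)"
      using x(1) R_carrier[OF N_R[OF x(2)]] R_carrier[OF x(3)] by algebra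
    also have "\<dots> \<in> J" using x(4) by simp
    finally show "\<ominus> x \<in> constant_mod J"
      using x by (intro constant_modI[of _ u "\<ominus> r"]) auto
  next
    fix x y assume "x \<in> constant_mod J" "y \<in> constant_mod J"
    then obtain u r v s where x: "x \<in> carrier S" "u \<in> N" "r \<in> R" "u \<otimes> x \<ominus> r \<in> J"
      and y: "y \<in> carrier S" "v \<in> N" "s \<in> R" "v \<otimes> y \<ominus> s \<in> J"
      by (elim constant_modE)
    note carr = x(1) y(1) R_carrier[OF N_R[OF x(2)]] R_carrier[OF x(3)]
      R_carrier[OF N_R[OF y(2)]] R_carrier[OF y(3)]
    have "(u \<otimes> v) \<otimes> (x \<otimes> y) \<ominus> r \<otimes> s = (u \<otimes> x) \<otimes> (v \<otimes> y \<ominus> s) \<oplus> s \<otimes> (u \<otimes> x \<ominus> r)"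
      using carr by algebra
    also have "\<dots> \<in> J"
      using carr by (intro J.a_closed J.I_l_closed[OF x(4)] J.I_l_closed[OF y(4)]) auto
    finally show "x \<otimes> y \<in> constant_mod J"
      using x y by (intro constant_modI[of _ "u \<otimes> v" "r \<otimes> s"]) auto
    have "(u \<otimes> v) \<otimes> (x \<oplus> y) \<ominus> (v \<otimes> r \<oplus> u \<otimes> s) = v \<otimes> (u \<otimes> x \<ominus> r) \<oplus> u \<otimes> (v \<otimes> y \<ominus> s)"
      using carr by algebra
    also have "\<dots> \<in> J"
      using carr by (intro J.a_closed J.I_l_closed[OF x(4)] J.I_l_closed[OF y(4)]) auto
    finally show "x \<oplus> y \<in> constant_mod J"
      using x y by (intro constant_modI[of _ "u \<otimes> v" "v \<otimes> r \<oplus> u \<otimes> s"]) auto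
  qed
  ultimately show ?thesis by (simp add: subalgebras_def)
qed

text \<open>
  An element that is constant on the set of primes given by \<open>K\<close>, which includes \<open>Q\<close>, and also on
  \<open>{Q, Q'}\<close>, is constant on the union: both constants agree at \<open>Q\<close>, hence differ by an element of \<open>P\<close>
  and agree at \<open>Q'\<close> too.
\<close>

lemma constant_mod_glue:
  assumes Q: "Q \<in> fiber" and Q': "Q' \<in> fiber" and K: "ideal K S" "K \<subseteq> Q"
    and x: "x \<in> constant_mod K" and x': "x \<in> constant_mod (Q \<inter> Q')"
  shows "x \<in> constant_mod (K \<inter> Q')"
proof -
  interpret K: ideal K S by fact
  interpret Q: ideal Q S by (rule fiberD[OF Q])
  interpret Q': ideal Q' S by (rule fiberD[OF Q'])
  obtain u r where u: "x \<in> carrier S" "u \<in> N" "r \<in> R" "u \<otimes> x \<ominus> r \<in> K"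
    using x by (rule constant_modE)
  obtain v s where v: "v \<in> N" "s \<in> R" "v \<otimes> x \<ominus> s \<in> Q" "v \<otimes> x \<ominus> s \<in> Q'"
    using x' by (rule constant_modE) auto
  note carr = u(1) R_carrier[OF N_R[OF u(2)]] R_carrier[OF u(3)]
    R_carrier[OF N_R[OF v(1)]] R_carrier[OF v(2)]
  have vu: "v \<otimes> (u \<otimes> x \<ominus> r) \<in> K" using carr by (intro K.I_l_closed u) auto
  have "v \<otimes> r \<ominus> u \<otimes> s = u \<otimes> (v \<otimes> x \<ominus> s) \<ominus> v \<otimes> (u \<otimes> x \<ominus> r)"
    using carr by algebra
  also have "\<dots> \<in> Q"
    using carr vu K(2) unfolding minus_eq[of "u \<otimes> _"] by (intro Q.a_closed Q.a_inv_closed Q.I_l_closed[OF v(3)]) auto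
  finally have "v \<otimes> r \<ominus> u \<otimes> s \<in> P"
    using u v by (intro fiberD(5)[OF Q]) auto
  then have *: "v \<otimes> r \<ominus> u \<otimes> s \<in> Q'" by (rule fiberD(4)[OF Q'])
  have eq: "(u \<otimes> v) \<otimes> x \<ominus> v \<otimes> r = v \<otimes> (u \<otimes> x \<ominus> r)"
    using carr by algebra
  have eq': "(u \<otimes> v) \<otimes> x \<ominus> v \<otimes> r = u \<otimes> (v \<otimes> x \<ominus> s) \<oplus> (\<ominus> (v \<otimes> r \<ominus> u \<otimes> s))"
    using carr by algebra
  have "(u \<otimes> v) \<otimes> x \<ominus> v \<otimes> r \<in> K" unfolding eq by (rule vu)
  moreover have "(u \<otimes> v) \<otimes> x \<ominus> v \<otimes> r \<in> Q'"
    unfolding eq' using carr by (intro Q'.a_closed Q'.a_inv_closed[OF *] Q'.I_l_closed[OF v(4)]) auto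
  ultimately show ?thesis
    using u v by (intro constant_modI[of _ "u \<otimes> v" "v \<otimes> r"]) auto
qed

text \<open>
  If \<open>x \<in> Q'\<close> has the value \<open>r / u\<close> at the smaller prime \<open>Q\<close>, then \<open>r \<in> Q' \<inter> R = P\<close>, so this value
  is zero.
\<close>

lemma fiber_incomparable:
  assumes res: "\<And>Q x. \<lbrakk>Q \<in> fiber; x \<in> carrier S\<rbrakk> \<Longrightarrow> \<exists>u \<in> N. \<exists>r \<in> R. u \<otimes> x \<ominus> r \<in> Q"
    and Q: "Q \<in> fiber" and Q': "Q' \<in> fiber" and sub: "Q \<subseteq> Q'"
  shows "Q = Q'"
proof -
  interpret Q: ideal Q S by (rule fiberD[OF Q])
  interpret Q': ideal Q' S by (rule fiberD[OF Q'])
  have "x \<in> Q" if x: "x \<in> Q'" for x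
  proof -
    have xS: "x \<in> carrier S" using x by (rule Q'.Icarr)
    obtain u r where ur: "u \<in> N" "r \<in> R" "u \<otimes> x \<ominus> r \<in> Q" using res[OF Q xS] by blast
    have uS: "u \<in> carrier S" and rS: "r \<in> carrier S" using ur by auto
    have "r = u \<otimes> x \<oplus> (\<ominus> (u \<otimes> x \<ominus> r))" using uS rS xS by algebra
    also have "\<dots> \<in> Q'"
      using ur(3) sub by (intro Q'.a_closed Q'.a_inv_closed Q'.I_l_closed[OF x uS]) auto
    finally have "r \<in> Q" using fiberD(4)[OF Q] fiberD(5)[OF Q' ur(2)] by blast
    have "u \<otimes> x = (u \<otimes> x \<ominus> r) \<oplus> r" using uS rS xS by algebra
    also have "\<dots> \<in> Q" by (rule Q.a_closed[OF ur(3) \<open>r \<in> Q\<close>])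
    finally show "x \<in> Q" using fiberD(6)[OF Q ur(1)] fiberD(7)[OF Q uS xS] by blast
  qed
  then show ?thesis using sub by blast
qed

text \<open>
  The elements constant on \<open>{Q1, Q2}\<close>, on \<open>{Q1, Q3}\<close> and on \<open>{Q2, Q3}\<close> form subalgebras \<open>T\<close>, \<open>U\<close> and
  \<open>V\<close>. Gluing shows that \<open>T \<inter> U\<close> and \<open>T \<inter> V\<close> consist of elements constant on all three primes.
  On the other hand, an element \<open>x\<close> that vanishes at \<open>Q1\<close> and \<open>Q2\<close> but not at \<open>Q3\<close> lies in \<open>T\<close>
  without being constant on the three primes, and it can be chosen in the compositum \<open>U V\<close>: subtract
  from a constant of \<open>R - P\<close> an element \<open>g1 \<in> V\<close> supported at \<open>Q1\<close> and an element \<open>h1 \<in> U\<close>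
  supported at \<open>Q2\<close>.
\<close>

lemma three_primes_not_distributive:
  assumes res: "\<And>Q x. \<lbrakk>Q \<in> fiber; x \<in> carrier S\<rbrakk> \<Longrightarrow> \<exists>u \<in> N. \<exists>r \<in> R. u \<otimes> x \<ominus> r \<in> Q"
    and Q1: "Q1 \<in> fiber" and Q2: "Q2 \<in> fiber" and Q3: "Q3 \<in> fiber"
    and distinct: "Q1 \<noteq> Q2" "Q1 \<noteq> Q3" "Q2 \<noteq> Q3"
  shows "\<not> distributive_extension S R"
proof
  assume dist: "distributive_extension S R"
  interpret Q1: ideal Q1 S by (rule fiberD[OF Q1])
  interpret Q2: ideal Q2 S by (rule fiberD[OF Q2])
  interpret Q3: ideal Q3 S by (rule fiberD[OF Q3])
  have separate: "\<exists>g. g \<in> A \<inter> B \<and> g \<notin> C \<and> g \<in> carrier S"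
    if "A \<in> fiber" "B \<in> fiber" "C \<in> fiber" "A \<noteq> C" "B \<noteq> C" for A B C
  proof -
    have "\<not> A \<subseteq> C" "\<not> B \<subseteq> C" using fiber_incomparable[OF res] that by blast+
    then obtain a b where ab: "a \<in> A" "a \<notin> C" "b \<in> B" "b \<notin> C" by blast
    have carr: "a \<in> carrier S" "b \<in> carrier S"
      using ideal.Icarr[OF fiberD(2)] that ab by blast+
    have "a \<otimes> b \<in> A" "a \<otimes> b \<in> B"
      using ideal.I_r_closed[OF fiberD(2)[OF that(1)] ab(1) carr(2)]
        ideal.I_l_closed[OF fiberD(2)[OF that(2)] ab(3) carr(1)] by auto
    moreover have "a \<otimes> b \<notin> C" using fiberD(7)[OF that(3) carr] ab by blast
    ultimately show ?thesis using carr by (intro exI[of _ "a \<otimes> b"]) auto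
  qed
  have unit_value: "\<exists>u \<in> N. \<exists>r \<in> N. u \<otimes> g \<ominus> r \<in> Q" if Q: "Q \<in> fiber" and g: "g \<in> carrier S" "g \<notin> Q" for Q g
  proof -
    interpret Q: ideal Q S by (rule fiberD[OF Q])
    obtain u r where ur: "u \<in> N" "r \<in> R" "u \<otimes> g \<ominus> r \<in> Q" using res[OF Q g(1)] by blast
    have uS: "u \<in> carrier S" and rS: "r \<in> carrier S" using ur by auto
    have "r \<notin> P"
    proof
      assume "r \<in> P"
      have "u \<otimes> g = (u \<otimes> g \<ominus> r) \<oplus> r" using uS rS g(1) by algebra
      also have "\<dots> \<in> Q" by (rule Q.a_closed[OF ur(3) fiberD(4)[OF Q \<open>r \<in> P\<close>]])
      finally show False using fiberD(6)[OF Q ur(1)] fiberD(7)[OF Q uS g(1)] g(2) by blast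
    qed
    then show ?thesis using ur by (auto simp: N_def)
  qed
  obtain g where g: "g \<in> Q2" "g \<in> Q3" "g \<notin> Q1" "g \<in> carrier S"
    using separate[OF Q2 Q3 Q1] distinct by auto
  obtain h where h: "h \<in> Q1" "h \<in> Q3" "h \<notin> Q2" "h \<in> carrier S"
    using separate[OF Q1 Q3 Q2] distinct by auto
  obtain u r where ur: "u \<in> N" "r \<in> N" "u \<otimes> g \<ominus> r \<in> Q1" using unit_value[OF Q1 g(4,3)] by blast
  obtain v s where vs: "v \<in> N" "s \<in> N" "v \<otimes> h \<ominus> s \<in> Q2" using unit_value[OF Q2 h(4,3)] by blast
  have carr: "u \<in> carrier S" "r \<in> carrier S" "v \<in> carrier S" "s \<in> carrier S"
    using ur vs by auto
  \<comment> \<open>The factors are chosen such that \<open>g1\<close> at \<open>Q1\<close> and \<open>h1\<close> at \<open>Q2\<close> take the common value \<open>r s\<close>.\<close>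
  define g1 where "g1 = (s \<otimes> u) \<otimes> g"
  define h1 where "h1 = (r \<otimes> v) \<otimes> h"
  define x where "x = r \<otimes> s \<ominus> g1 \<ominus> h1"
  have g1: "g1 \<in> Q2" "g1 \<in> Q3" "g1 \<in> carrier S"
    using g carr by (auto simp: g1_def intro: Q2.I_l_closed Q3.I_l_closed)
  have h1: "h1 \<in> Q1" "h1 \<in> Q3" "h1 \<in> carrier S"
    using h carr by (auto simp: h1_def intro: Q1.I_l_closed Q3.I_l_closed)
  have xS: "x \<in> carrier S" using g1 h1 carr by (simp add: x_def)
  have "x = \<ominus> (s \<otimes> (u \<otimes> g \<ominus> r)) \<oplus> (\<ominus> h1)"
    unfolding x_def g1_def using carr g(4) h1(3) by algebra
  also have "\<dots> \<in> Q1" by (intro Q1.a_closed Q1.a_inv_closed Q1.I_l_closed[OF ur(3)] h1 carr)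
  finally have xQ1: "x \<in> Q1" .
  have "x = \<ominus> (r \<otimes> (v \<otimes> h \<ominus> s)) \<oplus> (\<ominus> g1)"
    unfolding x_def h1_def using carr h(4) g1(3) by algebra
  also have "\<dots> \<in> Q2" by (intro Q2.a_closed Q2.a_inv_closed Q2.I_l_closed[OF vs(3)] g1 carr)
  finally have xQ2: "x \<in> Q2" .
  have xQ3: "x \<notin> Q3"
  proof
    assume "x \<in> Q3"
    have "r \<otimes> s = x \<oplus> g1 \<oplus> h1" unfolding x_def using carr g1(3) h1(3) by algebra
    also have "\<dots> \<in> Q3" by (intro Q3.a_closed \<open>x \<in> Q3\<close> g1 h1)
    finally show False using fiberD(6)[OF Q3 N_mult[OF ur(2) vs(2)]] by blast
  qed
  have I12: "ideal (Q1 \<inter> Q2) S" and I13: "ideal (Q1 \<inter> Q3) S" and I23: "ideal (Q2 \<inter> Q3) S"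
    by (intro i_intersect Q1.ideal_axioms Q2.ideal_axioms Q3.ideal_axioms)+
  define T U V where "T = constant_mod (Q1 \<inter> Q2)" and "U = constant_mod (Q1 \<inter> Q3)"
    and "V = constant_mod (Q2 \<inter> Q3)"
  have TUV: "T \<in> subalgebras S R" "U \<in> subalgebras S R" "V \<in> subalgebras S R"
    unfolding T_def U_def V_def using I12 I13 I23 by (auto intro: constant_mod_subalgebra)
  then have carrT: "T \<subseteq> carrier S" "U \<subseteq> carrier S" "V \<subseteq> carrier S" and RU: "R \<subseteq> U"
    using subringE(1) by (auto simp: subalgebras_def)
  have W: "subring (compositum S U V) S"
    unfolding compositum_def using carrT by (intro generate_ring_is_subring) auto
  have UV: "U \<union> V \<subseteq> compositum S U V" unfolding compositum_def by (auto intro: generate_ring.incl)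
  have "g1 \<in> V" unfolding V_def using g1 by (intro ideal_subset_constant_mod I23) auto
  moreover have "h1 \<in> U" unfolding U_def using h1 by (intro ideal_subset_constant_mod I13) auto
  moreover have "r \<otimes> s \<in> U" using RU N_R[OF N_mult[OF ur(2) vs(2)]] by blast
  ultimately have "x \<in> compositum S U V"
    unfolding x_def minus_eq using UV by (intro subringE(5,7)[OF W]) auto
  moreover have "x \<in> T" unfolding T_def using xQ1 xQ2 by (intro ideal_subset_constant_mod I12) auto
  moreover have "T \<inter> compositum S U V = compositum S (T \<inter> U) (T \<inter> V)"
    using dist TUV unfolding distributive_extension_def by blast
  ultimately have "x \<in> compositum S (T \<inter> U) (T \<inter> V)" by blast
  moreover have "compositum S (T \<inter> U) (T \<inter> V) \<subseteq> constant_mod (Q1 \<inter> Q2 \<inter> Q3)"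
    unfolding compositum_def
  proof (rule generate_ring_min_subring1)
    show "T \<inter> U \<union> T \<inter> V \<subseteq> carrier S" using carrT by blast
    show "subring (constant_mod (Q1 \<inter> Q2 \<inter> Q3)) S"
      using constant_mod_subalgebra[OF i_intersect[OF I12 Q3.ideal_axioms]] by (simp add: subalgebras_def)
    show "T \<inter> U \<union> T \<inter> V \<subseteq> constant_mod (Q1 \<inter> Q2 \<inter> Q3)"
      using constant_mod_glue[OF Q1 Q3 I12] constant_mod_glue[OF Q2 Q3 I12]
      unfolding T_def U_def V_def by blast
  qed
  ultimately have "x \<in> constant_mod (Q1 \<inter> Q2 \<inter> Q3)" by blast
  then obtain w t where w: "w \<in> N" "t \<in> R" "w \<otimes> x \<ominus> t \<in> Q1" "w \<otimes> x \<ominus> t \<in> Q3"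
    by (rule constant_modE) auto
  have wS: "w \<in> carrier S" and tS: "t \<in> carrier S" using w by auto
  have "t = w \<otimes> x \<oplus> (\<ominus> (w \<otimes> x \<ominus> t))" using wS tS xS by algebra
  also have "\<dots> \<in> Q1" by (intro Q1.a_closed Q1.a_inv_closed w Q1.I_l_closed[OF xQ1] wS)
  finally have tQ3: "t \<in> Q3" using fiberD(4)[OF Q3] fiberD(5)[OF Q1 w(2)] by blast
  have "w \<otimes> x = (w \<otimes> x \<ominus> t) \<oplus> t" using wS tS xS by algebra
  also have "\<dots> \<in> Q3" by (rule Q3.a_closed[OF w(4) tQ3])
  finally show False using fiberD(6)[OF Q3 w(1)] fiberD(7)[OF Q3 wS xS] xQ3 by blast
qed

end

section \<open>At most two primes in a fiber\<close>

context ring_extension_prime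
begin

lemma sat_P_Int_R: "\<lbrakk>r \<in> sat P; r \<in> R\<rbrakk> \<Longrightarrow> r \<in> P"
  using P_prime N_not_P N_R unfolding sat_def by blast

lemma sat_P_subset_sat_R: "sat P \<subseteq> sat R"
  by (rule sat_mono) auto

text \<open>
  If \<open>b\<^sup>2\<close> lies in the ideal \<open>sat P\<close>, so does \<open>b\<^sup>3\<close>; seminormality then gives \<open>b \<in> sat R\<close>, and
  primality of \<open>P\<close> gives \<open>b \<in> sat P\<close>.
\<close>

lemma radical_sat_P:
  assumes sn: "seminormal_extension S R" and M: "ideal (sat P) S"
    and b: "b \<in> carrier S" "b \<otimes> b \<in> sat P"
  shows "b \<in> sat P"
proof -
  have "b \<otimes> b \<otimes> b \<in> sat P" by (rule ideal.I_r_closed[OF M b(2,1)])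
  then have "b \<in> sat R"
    using b sat_P_subset_sat_R by (intro seminormal_sat[OF sn b(1)]) auto
  then obtain u where u: "u \<in> N" "u \<otimes> b \<in> R" by (auto simp: sat_def)
  obtain v where v: "v \<in> N" "v \<otimes> (b \<otimes> b) \<in> P" using b(2) by (auto simp: sat_def)
  have carr: "u \<in> carrier S" "v \<in> carrier S" using u v by auto
  have "(v \<otimes> (u \<otimes> b)) \<otimes> (u \<otimes> b) = (u \<otimes> u) \<otimes> (v \<otimes> (b \<otimes> b))"
    using carr b(1) by algebra
  also have "\<dots> \<in> P" using u v by simp
  finally have "v \<otimes> (u \<otimes> b) \<in> P \<or> u \<otimes> b \<in> P"
    by (rule P_prime[rotated 2]) (use u v in simp_all)
  then have "u \<otimes> b \<in> P"
    using P_prime[OF N_R[OF v(1)] u(2)] N_not_P[OF v(1)] by blast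
  then show ?thesis by (rule satI[OF b(1) u(1)])
qed

text \<open>
  The radical ideal \<open>sat P\<close> is the intersection of the primes over \<open>P\<close>. The products of elements of
  \<open>R - P\<close> with powers of \<open>x\<close> form a multiplicative subset that misses \<open>sat P\<close>, and a prime that contains
  \<open>sat P\<close> and misses this subset meets \<open>R\<close> exactly in \<open>P\<close>.
\<close>

lemma exists_fiber_avoiding:
  assumes M: "ideal (sat P) S"
    and rad: "\<And>b. \<lbrakk>b \<in> carrier S; b \<otimes> b \<in> sat P\<rbrakk> \<Longrightarrow> b \<in> sat P"
    and x: "x \<in> carrier S" "x \<notin> sat P"
  shows "\<exists>Q \<in> fiber. x \<notin> Q"
proof -
  interpret M: ideal "sat P" S by (rule M)
  have pow: "x [^] n \<notin> sat P" for n :: nat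
  proof (induction n)
    case 0
    show ?case
    proof
      assume "x [^] (0::nat) \<in> sat P"
      then show False using M.one_imp_carrier x by simp
    qed
  next
    case (Suc n)
    show ?case
    proof (cases n)
      case 0
      then show ?thesis using x by simp
    next
      case (Suc k)
      \<comment> \<open>The square of \<open>x\<^sup>n\<close> is a multiple of \<open>x\<^sup>n\<^sup>+\<^sup>1\<close> as soon as \<open>n \<ge> 1\<close>.\<close>
      have "x [^] n \<otimes> x [^] n = x [^] Suc n \<otimes> x [^] k"
        using x(1) by (simp add: Suc m_ac)
      then have "x [^] n \<otimes> x [^] n \<in> sat P" if "x [^] Suc n \<in> sat P"
        using M.I_r_closed[OF that, of "x [^] k"] x(1) by simp
      then show ?thesis using rad[of "x [^] n"] Suc.IH x(1) by auto
    qed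
  qed
  define N' where "N' = {w. \<exists>u \<in> N. \<exists>n :: nat. w = u \<otimes> x [^] n}"
  have mult: "multiplicative_subset S N'"
  proof (intro multiplicative_subset.intro multiplicative_subset_axioms.intro is_cring)
    show "N' \<subseteq> carrier S" using x(1) by (auto simp: N'_def)
    have "\<one> = \<one> \<otimes> x [^] (0::nat)" by simp
    then show "\<one> \<in> N'" unfolding N'_def using N.M_one by blast
  next
    fix s t assume "s \<in> N'" "t \<in> N'"
    then obtain u v and m n :: nat where uv: "u \<in> N" "v \<in> N"
      and st: "s = u \<otimes> x [^] m" "t = v \<otimes> x [^] n"
      unfolding N'_def by blast
    have "s \<otimes> t = (u \<otimes> v) \<otimes> x [^] (m + n)"
      using uv x(1) by (simp add: st nat_pow_mult[symmetric] m_ac)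
    then show "s \<otimes> t \<in> N'" unfolding N'_def using N_mult[OF uv] by blast
  qed
  have "sat P \<inter> N' = {}"
  proof (rule ccontr)
    assume "sat P \<inter> N' \<noteq> {}"
    then obtain u and n :: nat where "u \<in> N" "u \<otimes> x [^] n \<in> sat P"
      unfolding N'_def by blast
    then show False using saturatedD[OF saturated_sat] pow x(1) by blast
  qed
  then obtain Q where Q: "primeideal Q S" "sat P \<subseteq> Q" "Q \<inter> N' = {}"
    using exists_primeideal_avoiding[OF M mult] by blast
  have "u \<in> N'" if "u \<in> N" for u
  proof -
    have "u = u \<otimes> x [^] (0::nat)" using that by simp
    then show ?thesis unfolding N'_def using that by blast
  qed
  then have "Q \<inter> N = {}" using Q(3) by blast
  moreover have "P \<subseteq> Q" using Q(2) subset_sat[of P] P_R R_carrier by blast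
  ultimately have "Q \<inter> R = P" by (auto simp: N_def)
  moreover have "x \<in> N'"
  proof -
    have "x = \<one> \<otimes> x [^] (1::nat)" using x(1) by simp
    then show ?thesis unfolding N'_def using N.M_one by blast
  qed
  ultimately show ?thesis using Q by (auto simp: fiber_def)
qed

text \<open>
  In the picture \<open>k \<subseteq> k\<^sup>2\<close>, a nonconstant element \<open>t\<close> and the constants generate \<open>k\<^sup>2\<close>. Shifting \<open>t\<close> by its
  value at \<open>Q1\<close> gives \<open>e \<in> T\<close> that vanishes at \<open>Q1\<close> only. For an arbitrary \<open>s\<close>, let \<open>d\<close> be its shift
  by its value at \<open>Q1\<close>; a multiple of \<open>e\<close> cancels the value of \<open>d\<close> at \<open>Q2\<close>, and what is left lies in
  \<open>Q1 \<inter> Q2\<close>, hence in \<open>T\<close>. The case \<open>Q1 = Q2\<close>, a fiber with one prime, is included: there \<open>e\<close> cannot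
  exist.
\<close>

lemma two_primes_simple:
  assumes res: "\<And>Q x. \<lbrakk>Q \<in> fiber; x \<in> carrier S\<rbrakk> \<Longrightarrow> \<exists>u \<in> N. \<exists>r \<in> R. u \<otimes> x \<ominus> r \<in> Q"
    and Q1: "Q1 \<in> fiber" and Q2: "Q2 \<in> fiber" and radical: "Q1 \<inter> Q2 \<subseteq> sat R"
    and T: "T \<in> subalgebras S R" "saturated T" and t: "t \<in> T" "t \<notin> sat R"
  shows "T = carrier S"
proof -
  interpret Q1: ideal Q1 S by (rule fiberD[OF Q1])
  interpret Q2: ideal Q2 S by (rule fiberD[OF Q2])
  have subT: "subring T S" and RT: "R \<subseteq> T" using T by (auto simp: subalgebras_def)
  note TE = subringE[OF subT]
  note Tm = submod_minus[OF submod_subalgebra[OF T(1)]]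
  note Tr = submodD(4)[OF submod_subalgebra[OF T(1)]]
  note Rm = submodD[OF submod_sat[OF submod_R]]
  have sat_R_T: "sat R \<subseteq> T" by (rule sat_subset[OF RT T(2)])
  have tS: "t \<in> carrier S" using t(1) TE(1) by blast
  obtain u r where u: "u \<in> N" "r \<in> R" "u \<otimes> t \<ominus> r \<in> Q1" using res[OF Q1 tS] by blast
  define e where "e = u \<otimes> t \<ominus> r"
  have uS: "u \<in> carrier S" and rS: "r \<in> carrier S" using u by auto
  have e: "e \<in> Q1" "e \<in> T" "e \<in> carrier S"
    using u Tm[OF Tr[OF N_R[OF u(1)] t(1)]] RT uS rS tS by (auto simp: e_def)
  have eQ2: "e \<notin> Q2"
  proof
    assume "e \<in> Q2"
    then have "e \<in> sat R" using radical e by blast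
    moreover have "r \<in> sat R" using subset_sat[OF subringE(1)[OF subring_R]] u by blast
    moreover have "u \<otimes> t = e \<oplus> r" unfolding e_def using uS rS tS by algebra
    ultimately have "u \<otimes> t \<in> sat R" using Rm(3) by simp
    then show False using saturatedD[OF saturated_sat u(1) tS] t(2) by blast
  qed
  obtain w c where w: "w \<in> N" "c \<in> R" "w \<otimes> e \<ominus> c \<in> Q2" using res[OF Q2 e(3)] by blast
  have wS: "w \<in> carrier S" and cS: "c \<in> carrier S" using w by auto
  have "c \<notin> P"
  proof
    assume "c \<in> P"
    have "w \<otimes> e = (w \<otimes> e \<ominus> c) \<oplus> c" using wS cS e(3) by algebra
    also have "\<dots> \<in> Q2" by (rule Q2.a_closed[OF w(3) fiberD(4)[OF Q2 \<open>c \<in> P\<close>]])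
    finally show False using fiberD(6)[OF Q2 w(1)] fiberD(7)[OF Q2 wS e(3)] eQ2 by blast
  qed
  then have c: "c \<in> N" using w by (simp add: N_def)
  have "s \<in> T" if s: "s \<in> carrier S" for s
  proof -
    obtain v a where v: "v \<in> N" "a \<in> R" "v \<otimes> s \<ominus> a \<in> Q1" using res[OF Q1 s] by blast
    have vS: "v \<in> carrier S" and aS: "a \<in> carrier S" using v by auto
    define d where "d = v \<otimes> s \<ominus> a"
    have d: "d \<in> Q1" "d \<in> carrier S" using v vS aS s by (auto simp: d_def)
    obtain y b where y: "y \<in> N" "b \<in> R" "y \<otimes> d \<ominus> b \<in> Q2" using res[OF Q2 d(2)] by blast
    have yS: "y \<in> carrier S" and bS: "b \<in> carrier S" using y by auto
    define f where "f = c \<otimes> (y \<otimes> d) \<ominus> b \<otimes> (w \<otimes> e)"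
    have "f \<in> Q1"
      unfolding f_def minus_eq
      using d e yS wS by (intro Q1.a_closed Q1.a_inv_closed Q1.I_l_closed cS bS) auto
    have "f = c \<otimes> (y \<otimes> d \<ominus> b) \<ominus> b \<otimes> (w \<otimes> e \<ominus> c)"
      unfolding f_def using cS yS bS wS d(2) e(3) by algebra
    also have "\<dots> \<in> Q2"
      unfolding minus_eq[of "c \<otimes> _"]
      by (intro Q2.a_closed Q2.a_inv_closed Q2.I_l_closed[OF y(3)] Q2.I_l_closed[OF w(3)] cS bS)
    finally have "f \<in> Q2" .
    then have fT: "f \<in> T" using \<open>f \<in> Q1\<close> radical sat_R_T by blast
    have "(c \<otimes> y) \<otimes> d = f \<oplus> b \<otimes> (w \<otimes> e)"
      unfolding f_def using cS yS bS wS d(2) e(3) by algebra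
    also have "\<dots> \<in> T" by (intro TE(7) fT Tr e y(2) N_R w(1))
    finally have "d \<in> T" using saturatedD[OF T(2) N_mult[OF c y(1)] d(2)] by blast
    have "v \<otimes> s = d \<oplus> a" unfolding d_def using vS aS s by algebra
    also have "\<dots> \<in> T" using \<open>d \<in> T\<close> v(2) RT by (intro TE(7)) auto
    finally show ?thesis by (rule saturatedD[OF T(2) v(1) s])
  qed
  then show ?thesis using TE(1) by blast
qed

text \<open>
  Saturated subalgebras are the preimages of the subalgebras of \<open>S\<^sub>P\<close> over \<open>R\<^sub>P\<close>, so this says that
  \<open>R\<^sub>P\<close> and \<open>S\<^sub>P\<close> are the only ones.
\<close>

definition locally_simple :: bool where
  "locally_simple \<longleftrightarrow> (\<forall>T \<in> subalgebras S R. saturated T \<longrightarrow> T = sat R \<or> T = carrier S)"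

lemma distributive_imp_locally_simple:
  assumes "seminormal_extension S R" "infra_integral_extension S R" "FCP_extension S R"
    and dist: "distributive_extension S R"
  shows locally_simple
proof -
  have res: "\<And>Q x. \<lbrakk>Q \<in> fiber; x \<in> carrier S\<rbrakk> \<Longrightarrow> \<exists>u \<in> N. \<exists>r \<in> R. u \<otimes> x \<ominus> r \<in> Q"
    by (rule residue_fraction[OF assms(2)])
  have int: "integral_extension S R" using assms(2) by (simp add: infra_integral_extension_def)
  have M: "ideal (sat P) S"
    by (rule ideal_sat_P[OF P_conducts[OF assms(3) int assms(1)]])
  note avoid = exists_fiber_avoiding[OF M radical_sat_P[OF assms(1) M]]
  have "\<one> \<notin> sat P" using sat_P_Int_R[of \<one>] one_notin_P by auto
  then obtain Q1 where Q1: "Q1 \<in> fiber" using avoid[of \<one>] by auto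
  obtain Q2 where Q2: "Q2 \<in> fiber" and all: "fiber \<subseteq> {Q1, Q2}"
  proof (cases "fiber = {Q1}")
    case True
    then show ?thesis using that[of Q1] Q1 by simp
  next
    case False
    then obtain Q2 where "Q2 \<in> fiber" "Q2 \<noteq> Q1" using Q1 by blast
    then show ?thesis
      using that[of Q2] three_primes_not_distributive[OF res Q1, of Q2] dist by blast
  qed
  have radical: "Q1 \<inter> Q2 \<subseteq> sat R"
  proof
    fix x assume x: "x \<in> Q1 \<inter> Q2"
    then have "x \<in> carrier S" using ideal.Icarr[OF fiberD(2)[OF Q1]] by blast
    then have "x \<in> sat P" using avoid[of x] all x by blast
    then show "x \<in> sat R" using sat_P_subset_sat_R by blast
  qed
  show ?thesis
    unfolding locally_simple_def
  proof (intro ballI impI)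
    fix T assume T: "T \<in> subalgebras S R" "saturated T"
    have "sat R \<subseteq> T" using T by (intro sat_subset) (auto simp: subalgebras_def)
    moreover have "T = carrier S" if "\<not> T \<subseteq> sat R"
    proof -
      obtain t where "t \<in> T" "t \<notin> sat R" using \<open>\<not> T \<subseteq> sat R\<close> by blast
      then show ?thesis using two_primes_simple[OF res Q1 Q2 radical T] by blast
    qed
    ultimately show "T = sat R \<or> T = carrier S" by blast
  qed
qed

section \<open>Transfer to the localization\<close>

text \<open>
  The localization \<open>T\<^sub>P\<close> as a subset of \<open>S\<^sub>P\<close>.
\<close>

definition loc :: "'a set \<Rightarrow> ('a \<times> 'a) set set" where
  "loc T = {fraction S N x s | x s. x \<in> T \<and> s \<in> N}"

lemma loc_mono: "T \<subseteq> U \<Longrightarrow> loc T \<subseteq> loc U"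
  unfolding loc_def by blast

lemma loc_ring_eq: "loc_ring S R P = N.Loc"
  by (simp add: loc_ring_def N_def)

lemma loc_subring_eq: "loc_subring S R P = loc R"
proof -
  interpret NA: multiplicative_subset "S\<lparr>carrier := R\<rparr>" N by (rule multiplicative_N)
  have N_sub: "N \<subseteq> R" by auto
  have eq: "loc_map S N (fraction (S\<lparr>carrier := R\<rparr>) N r s) = fraction S N r s" if "r \<in> R" "s \<in> N" for r s
    by (rule loc_map_fraction[OF N.multiplicative_subset_axioms order_refl that N_sub multiplicative_N])
  have carr: "carrier NA.Loc = {fraction (S\<lparr>carrier := R\<rparr>) N r s | r s. r \<in> R \<and> s \<in> N}"
    unfolding NA.carrier_Loc by simp
  show ?thesis
    unfolding loc_subring_def N_def[symmetric] carr loc_def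
  proof (intro equalityI subsetI)
    fix y assume "y \<in> loc_map S N ` {fraction (S\<lparr>carrier := R\<rparr>) N r s | r s. r \<in> R \<and> s \<in> N}"
    then obtain r s where "r \<in> R" "s \<in> N" "y = loc_map S N (fraction (S\<lparr>carrier := R\<rparr>) N r s)" by blast
    then show "y \<in> {fraction S N x s | x s. x \<in> R \<and> s \<in> N}" using eq by blast
  next
    fix y assume "y \<in> {fraction S N x s | x s. x \<in> R \<and> s \<in> N}"
    then obtain r s where "r \<in> R" "s \<in> N" "y = fraction S N r s" by blast
    then show "y \<in> loc_map S N ` {fraction (S\<lparr>carrier := R\<rparr>) N r s | r s. r \<in> R \<and> s \<in> N}"
      using eq[of r s] by (intro image_eqI[of _ _ "fraction (S\<lparr>carrier := R\<rparr>) N r s"]) auto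
  qed
qed

lemma loc_carrier: "loc (carrier S) = carrier N.Loc"
  by (simp add: loc_def N.carrier_Loc)

lemma loc_subalgebra:
  assumes T: "T \<in> subalgebras S R"
  shows "loc T \<in> subalgebras N.Loc (loc R)"
proof -
  interpret L: cring N.Loc by (rule N.cring_Loc)
  have subT: "subring T S" and RT: "R \<subseteq> T" using T by (auto simp: subalgebras_def)
  note TE = subringE[OF subT]
  have TS: "x \<in> carrier S" if "x \<in> T" for x using that TE(1) by blast
  note Tr = submodD(4)[OF submod_subalgebra[OF T]]
  have "subring (loc T) N.Loc"
  proof (rule L.subringI)
    show "loc T \<subseteq> carrier N.Loc"
      using TS unfolding loc_def by auto
    show "\<one>\<^bsub>N.Loc\<^esub> \<in> loc T" using TE(3) N.M_one unfolding loc_def N.one_Loc by blast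
  next
    fix h assume "h \<in> loc T"
    then obtain x s where "x \<in> T" "s \<in> N" "h = fraction S N x s" unfolding loc_def by blast
    then show "\<ominus>\<^bsub>N.Loc\<^esub> h \<in> loc T"
      using N.minus_fraction[OF TS] TE(5) unfolding loc_def by blast
  next
    fix h k assume "h \<in> loc T" "k \<in> loc T"
    then obtain x s y t where h: "x \<in> T" "s \<in> N" "h = fraction S N x s"
      and k: "y \<in> T" "t \<in> N" "k = fraction S N y t"
      unfolding loc_def by blast
    have "h \<otimes>\<^bsub>N.Loc\<^esub> k = fraction S N (x \<otimes> y) (s \<otimes> t)"
      using N.mult_fraction TS h k by simp
    then show "h \<otimes>\<^bsub>N.Loc\<^esub> k \<in> loc T"
      using TE(6)[OF h(1) k(1)] N_mult[OF h(2) k(2)] unfolding loc_def by blast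
    have "h \<oplus>\<^bsub>N.Loc\<^esub> k = fraction S N (x \<otimes> t \<oplus> y \<otimes> s) (s \<otimes> t)"
      using N.add_fraction TS h k by simp
    moreover have "x \<otimes> t \<oplus> y \<otimes> s \<in> T"
      using h k RT N_R by (intro TE(6,7)) auto
    ultimately show "h \<oplus>\<^bsub>N.Loc\<^esub> k \<in> loc T"
      using N_mult[OF h(2) k(2)] unfolding loc_def by blast
  qed
  moreover have "loc R \<subseteq> loc T" using RT unfolding loc_def by blast
  ultimately show ?thesis by (simp add: subalgebras_def)
qed

lemma fraction_in_loc_iff:
  assumes T: "T \<in> subalgebras S R" and x: "x \<in> carrier S"
  shows "fraction S N x \<one> \<in> loc T \<longleftrightarrow> x \<in> sat T"
proof
  have TS: "y \<in> carrier S" if "y \<in> T" for y using that subringE(1) T by (auto simp: subalgebras_def)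
  {
    assume "fraction S N x \<one> \<in> loc T"
    then obtain t s where ts: "t \<in> T" "s \<in> N" "fraction S N x \<one> = fraction S N t s"
      unfolding loc_def by blast
    then have "\<exists>u \<in> N. u \<otimes> (x \<otimes> s) = u \<otimes> (t \<otimes> \<one>)"
      using N.fraction_eq_iff[OF x N.M_one TS ts(2)] by blast
    then obtain u where u: "u \<in> N" "u \<otimes> (x \<otimes> s) = u \<otimes> (t \<otimes> \<one>)" by blast
    have "(u \<otimes> s) \<otimes> x = u \<otimes> (x \<otimes> s)" using u(1) ts(2) x by (simp add: m_ac)
    also have "\<dots> = u \<otimes> t" using u TS[OF ts(1)] by simp
    also have "\<dots> \<in> T" by (rule submodD(4)[OF submod_subalgebra[OF T] N_R[OF u(1)] ts(1)])
    finally show "x \<in> sat T" by (rule satI[OF x N_mult[OF u(1) ts(2)]])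
  next
    assume "x \<in> sat T"
    then obtain u where u: "u \<in> N" "u \<otimes> x \<in> T" by (auto simp: sat_def)
    have "fraction S N x \<one> = fraction S N (u \<otimes> x) u"
      using u x by (intro N.fraction_eqI N.M_one) (auto simp: m_comm)
    then show "fraction S N x \<one> \<in> loc T" unfolding loc_def using u by blast
  }
qed

lemma sat_carrier_eq: "sat (carrier S) = carrier S"
  using subset_sat[of "carrier S"] by (auto simp: sat_def)

lemma carrier_subalgebra: "carrier S \<in> subalgebras S R"
  using carrier_is_subring by (auto simp: subalgebras_def)

lemma loc_sat:
  assumes "T \<in> subalgebras S R"
  shows "loc (sat T) = loc T"
proof
  have TS: "T \<subseteq> carrier S" using subringE(1) assms by (auto simp: subalgebras_def)
  then show "loc T \<subseteq> loc (sat T)" unfolding loc_def using subset_sat[OF TS] by blast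
  show "loc (sat T) \<subseteq> loc T"
  proof
    fix y assume "y \<in> loc (sat T)"
    then obtain x s where xs: "x \<in> sat T" "s \<in> N" "y = fraction S N x s" unfolding loc_def by blast
    then obtain u where u: "u \<in> N" "u \<otimes> x \<in> T" "x \<in> carrier S" by (auto simp: sat_def)
    have "y = fraction S N (u \<otimes> x) (u \<otimes> s)"
      unfolding xs(3) using u xs(2) by (intro N.fraction_eqI) (auto simp: m_ac)
    then show "y \<in> loc T" unfolding loc_def using u(2) N_mult[OF u(1) xs(2)] by blast
  qed
qed

text \<open>
  The preimage of \<open>B\<close> in \<open>S\<close> is saturated because \<open>B\<close> contains the fractions \<open>1 / u\<close> with
  \<open>u \<in> R - P\<close>.
\<close>

lemma subalgebra_of_loc:
  assumes B: "B \<in> subalgebras N.Loc (loc R)"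
  obtains T where "T \<in> subalgebras S R" "saturated T" "B = loc T"
proof -
  interpret L: cring N.Loc by (rule N.cring_Loc)
  have subB: "subring B N.Loc" and RB: "loc R \<subseteq> B" using B by (auto simp: subalgebras_def)
  note BE = subringE[OF subB]
  define T where "T = {x \<in> carrier S. fraction S N x \<one> \<in> B}"
  have T: "T \<in> subalgebras S R"
  proof -
    have "subring T S"
    proof (rule subringI)
      show "T \<subseteq> carrier S" by (auto simp: T_def)
      show "\<one> \<in> T" using BE(3) by (simp add: T_def N.one_Loc)
    next
      fix h assume "h \<in> T"
      then show "\<ominus> h \<in> T"
        using BE(5)[of "fraction S N h \<one>"] N.minus_fraction[of h \<one>] N.M_one by (simp add: T_def)
    next
      fix h k assume "h \<in> T" "k \<in> T"
      then show "h \<otimes> k \<in> T" "h \<oplus> k \<in> T"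
        using BE(6,7)[of "fraction S N h \<one>" "fraction S N k \<one>"] N.M_one
          N.mult_fraction[of h \<one> k \<one>] N.add_fraction[of h \<one> k \<one>]
        by (simp_all add: T_def)
    qed
    moreover have "R \<subseteq> T"
    proof
      fix r assume "r \<in> R"
      then have "fraction S N r \<one> \<in> loc R" unfolding loc_def using N.M_one by blast
      then show "r \<in> T" using RB \<open>r \<in> R\<close> by (auto simp: T_def)
    qed
    ultimately show ?thesis by (simp add: subalgebras_def)
  qed
  have unit: "fraction S N \<one> u \<in> B" if "u \<in> N" for u
    using RB R_closed(2) that unfolding loc_def by blast
  have "saturated T"
    unfolding saturated_def
  proof (intro ballI impI)
    fix u x assume u: "u \<in> N" and x: "x \<in> carrier S" and "u \<otimes> x \<in> T"
    then have "fraction S N (u \<otimes> x) \<one> \<in> B" by (simp add: T_def)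
    then have "fraction S N \<one> u \<otimes>\<^bsub>N.Loc\<^esub> fraction S N (u \<otimes> x) \<one> \<in> B"
      by (rule BE(6)[OF unit[OF u]])
    moreover have "fraction S N \<one> u \<otimes>\<^bsub>N.Loc\<^esub> fraction S N (u \<otimes> x) \<one> = fraction S N (u \<otimes> x) u"
      using u x N.M_one by (simp add: N.mult_fraction)
    moreover have "\<dots> = fraction S N x \<one>"
      using u x N.M_one by (intro N.fraction_eqI) (auto simp: m_comm)
    ultimately show "x \<in> T" using x by (simp add: T_def)
  qed
  moreover have "B = loc T"
  proof
    show "loc T \<subseteq> B"
    proof
      fix y assume "y \<in> loc T"
      then obtain x s where xs: "x \<in> T" "s \<in> N" "y = fraction S N x s" unfolding loc_def by blast
      have "y = fraction S N \<one> s \<otimes>\<^bsub>N.Loc\<^esub> fraction S N x \<one>"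
        using xs N.M_one by (simp add: N.mult_fraction T_def)
      moreover have "fraction S N x \<one> \<in> B" using xs(1) by (simp add: T_def)
      ultimately show "y \<in> B" using BE(6)[OF unit[OF xs(2)]] by simp
    qed
    show "B \<subseteq> loc T"
    proof
      fix y assume y: "y \<in> B"
      then have "y \<in> carrier N.Loc" using BE(1) by blast
      then obtain x s where xs: "x \<in> carrier S" "s \<in> N" "y = fraction S N x s"
        unfolding N.carrier_Loc by blast
      have sB: "fraction S N s \<one> \<in> B"
        using RB N_R[OF xs(2)] N.M_one unfolding loc_def by blast
      have "fraction S N s \<one> \<otimes>\<^bsub>N.Loc\<^esub> y = fraction S N (s \<otimes> x) s"
        using xs N.M_one by (simp add: N.mult_fraction)
      also have "\<dots> = fraction S N x \<one>"
        using xs N.M_one by (intro N.fraction_eqI) (auto simp: m_comm)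
      finally have "fraction S N x \<one> \<in> B" using BE(6)[OF sB y] by simp
      then have "x \<in> T" using xs(1) by (simp add: T_def)
      then show "y \<in> loc T" unfolding loc_def using xs by blast
    qed
  qed
  ultimately show ?thesis using that T by blast
qed

lemma locally_simple_imp_minimal:
  assumes "locally_simple" and "P \<in> ext_support S R"
  shows "minimal_extension (loc_ring S R P) (loc_subring S R P)"
proof -
  have "loc R \<noteq> carrier N.Loc"
    using assms(2) by (simp add: ext_support_def loc_ring_eq loc_subring_eq)
  moreover have "B \<in> {loc R, carrier N.Loc}" if B: "B \<in> subalgebras N.Loc (loc R)" for B
  proof -
    obtain T where T: "T \<in> subalgebras S R" "saturated T" "B = loc T"
      using subalgebra_of_loc[OF B] .
    then have "T = sat R \<or> T = carrier S" using assms(1) by (auto simp: locally_simple_def)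
    then show ?thesis using T(3) loc_sat[OF R_subalgebra] loc_carrier by auto
  qed
  moreover have "loc R \<in> subalgebras N.Loc (loc R)" by (rule loc_subalgebra[OF R_subalgebra])
  moreover have "carrier N.Loc \<in> subalgebras N.Loc (loc R)"
    using loc_subalgebra[OF carrier_subalgebra] by (simp add: loc_carrier)
  ultimately show ?thesis
    unfolding minimal_extension_def loc_ring_eq loc_subring_eq by blast
qed

text \<open>
  Outside the support the two alternatives coincide, since there \<open>R\<^sub>P = S\<^sub>P\<close>.
\<close>

lemma minimal_imp_sat_cases:
  assumes "P \<in> ext_support S R \<Longrightarrow> minimal_extension (loc_ring S R P) (loc_subring S R P)"
    and T: "T \<in> subalgebras S R"
  shows "sat T = sat R \<or> sat T = carrier S"
proof -
  have spec: "P \<in> ring_spec (S\<lparr>carrier := R\<rparr>)" using prime_P by (simp add: ring_spec_def)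
  have sat_eq: "sat U = {x \<in> carrier S. fraction S N x \<one> \<in> loc U}" if "U \<in> subalgebras S R" for U
    using fraction_in_loc_iff[OF that] sat_carrier by blast
  have "loc T = loc R \<or> loc T = loc (carrier S)"
  proof (cases "P \<in> ext_support S R")
    case True
    then show ?thesis
      using assms(1) loc_subalgebra[OF T]
      by (auto simp: minimal_extension_def loc_ring_eq loc_subring_eq loc_carrier)
  next
    case False
    then have "loc R = loc (carrier S)"
      using spec by (simp add: ext_support_def loc_ring_eq loc_subring_eq loc_carrier)
    moreover have "loc R \<subseteq> loc T" "loc T \<subseteq> loc (carrier S)"
      using T subringE(1)[of T S] by (auto simp: subalgebras_def intro!: loc_mono)
    ultimately show ?thesis by blast
  qed
  then show ?thesis
    using sat_eq[OF T] sat_eq[OF R_subalgebra] sat_eq[OF carrier_subalgebra] sat_carrier_eq by auto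
qed

end

section \<open>From primes of the base ring to the whole extension\<close>

context ring_extension
begin

text \<open>
  Only \<open>T \<inter> U V \<subseteq> (T \<inter> U) (T \<inter> V)\<close> needs an argument. If \<open>x\<close> is on the left but not on the right, then
  the \<open>r \<in> R\<close> with \<open>r x\<close> on the right form a proper ideal, contained in a prime \<open>P\<close>. At \<open>P\<close> each of
  \<open>T\<close>, \<open>U\<close>, \<open>V\<close> becomes \<open>R\<^sub>P\<close> or \<open>S\<^sub>P\<close>, and in all cases \<open>x\<close> gets into the right-hand side after
  multiplication by an element outside \<open>P\<close>.
\<close>

lemma locally_minimal_imp_distributive:
  assumes lm: "locally_minimal_extension S R"
  shows "distributive_extension S R"
  unfolding distributive_extension_def
proof (intro ballI)
  fix T U V assume TUV: "T \<in> subalgebras S R" "U \<in> subalgebras S R" "V \<in> subalgebras S R"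
  then have sub: "subring T S" "subring U S" "subring V S" and R: "R \<subseteq> T" "R \<subseteq> U" "R \<subseteq> V"
    by (auto simp: subalgebras_def)
  have carr: "T \<subseteq> carrier S" "U \<subseteq> carrier S" "V \<subseteq> carrier S"
    using sub subringE(1) by blast+
  define W where "W = compositum S (T \<inter> U) (T \<inter> V)"
  have subW: "subring W S"
    unfolding W_def compositum_def using carr by (intro generate_ring_is_subring) auto
  have subUV: "subring (compositum S U V) S"
    unfolding compositum_def using carr by (intro generate_ring_is_subring) auto
  have inclW: "T \<inter> U \<subseteq> W" "T \<inter> V \<subseteq> W"
    unfolding W_def compositum_def by (auto intro: generate_ring.incl)
  have inclUV: "U \<subseteq> compositum S U V" "V \<subseteq> compositum S U V"
    unfolding compositum_def by (auto intro: generate_ring.incl)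
  have W: "W \<in> subalgebras S R" using subW inclW R by (auto simp: subalgebras_def)
  note Wsm = submodD[OF submod_subalgebra[OF W]]
  have "W \<subseteq> T \<inter> compositum S U V"
    unfolding W_def compositum_def[of S "T \<inter> U"]
    using carr inclUV by (intro generate_ring_min_subring1 subring_inter sub subUV) auto
  moreover have "x \<in> W" if xT: "x \<in> T" and xUV: "x \<in> compositum S U V" for x
  proof (rule ccontr)
    assume "x \<notin> W"
    have xS: "x \<in> carrier S" using xT carr by blast
    interpret A: cring "S\<lparr>carrier := R\<rparr>" by (rule cring_R)
    define I where "I = {r \<in> R. r \<otimes> x \<in> W}"
    have inv_R: "\<ominus>\<^bsub>S\<lparr>carrier := R\<rparr>\<^esub> r = \<ominus> r" if "r \<in> R" for r
      by (rule A.minus_equality) (use that in \<open>auto simp: l_neg\<close>)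
    have "ideal I (S\<lparr>carrier := R\<rparr>)"
    proof (rule idealI[OF A.ring_axioms])
      show "subgroup I (add_monoid (S\<lparr>carrier := R\<rparr>))"
      proof (rule A.add.subgroupI)
        show "I \<subseteq> carrier (S\<lparr>carrier := R\<rparr>)" by (auto simp: I_def)
        have "\<zero> \<in> I" using xS Wsm(2) by (simp add: I_def)
        then show "I \<noteq> {}" by blast
      next
        fix r assume r: "r \<in> I"
        then show "\<ominus>\<^bsub>S\<lparr>carrier := R\<rparr>\<^esub> r \<in> I"
          using inv_R[of r] xS submod_uminus[OF submod_subalgebra[OF W]] by (simp add: I_def l_minus)
      next
        fix r s assume "r \<in> I" "s \<in> I"
        then show "r \<oplus>\<^bsub>S\<lparr>carrier := R\<rparr>\<^esub> s \<in> I"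
          using xS Wsm(3) by (simp add: I_def l_distr)
      qed
      fix r s assume "r \<in> I" "s \<in> carrier (S\<lparr>carrier := R\<rparr>)"
      then show "s \<otimes>\<^bsub>S\<lparr>carrier := R\<rparr>\<^esub> r \<in> I" "r \<otimes>\<^bsub>S\<lparr>carrier := R\<rparr>\<^esub> s \<in> I"
        using xS Wsm(4)[of s "r \<otimes> x"] m_comm[of r s] by (simp_all add: I_def m_assoc)
    qed
    moreover have "I \<inter> {\<one>} = {}" using \<open>x \<notin> W\<close> xS by (simp add: I_def)
    moreover have "multiplicative_subset (S\<lparr>carrier := R\<rparr>) {\<one>}"
      by (intro multiplicative_subset.intro multiplicative_subset_axioms.intro cring_R) auto
    ultimately obtain P where P: "primeideal P (S\<lparr>carrier := R\<rparr>)" and IP: "I \<subseteq> P"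
      using A.exists_primeideal_avoiding[of I "{\<one>}"] by blast
    interpret P: ring_extension_prime S R P
      by (intro ring_extension_prime.intro ring_extension_axioms ring_extension_prime_axioms.intro P)
    have cases: "P.sat B = P.sat R \<or> P.sat B = carrier S" if "B \<in> subalgebras S R" for B
      using P.minimal_imp_sat_cases[OF _ that] lm by (auto simp: locally_minimal_extension_def)
    have meet: "x \<in> P.sat W" if "B \<in> {U, V}" "P.sat T = carrier S" "P.sat B = carrier S" for B
    proof -
      have "x \<in> P.sat T" "x \<in> P.sat B" using that xS by auto
      then obtain u v where uv: "u \<in> P.N" "u \<otimes> x \<in> T" "v \<in> P.N" "v \<otimes> x \<in> B"
        by (auto simp: P.sat_def)
      have B: "B \<in> subalgebras S R" and TB: "T \<inter> B \<subseteq> W" using that(1) TUV inclW by auto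
      have "(u \<otimes> v) \<otimes> x = v \<otimes> (u \<otimes> x)" "(u \<otimes> v) \<otimes> x = u \<otimes> (v \<otimes> x)"
        using uv xS by (simp_all add: m_ac)
      moreover have "v \<otimes> (u \<otimes> x) \<in> T" "u \<otimes> (v \<otimes> x) \<in> B"
        using uv submodD(4)[OF submod_subalgebra] TUV(1) B by auto
      ultimately have "(u \<otimes> v) \<otimes> x \<in> W" using TB by auto
      then show ?thesis by (rule P.satI[OF xS P.N_mult[OF uv(1,3)]])
    qed
    have RW: "P.sat R \<subseteq> P.sat W" using W by (intro P.sat_mono) (auto simp: subalgebras_def)
    have "x \<in> P.sat W"
    proof (cases "P.sat T = carrier S \<and> (P.sat U = carrier S \<or> P.sat V = carrier S)")
      case True
      then show ?thesis using meet by blast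
    next
      case False
      then consider "P.sat T = P.sat R" | "P.sat U = P.sat R" "P.sat V = P.sat R"
        using cases TUV by blast
      then have "x \<in> P.sat R"
      proof cases
        case 1
        then show ?thesis using P.subset_sat[OF carr(1)] xT by blast
      next
        case 2
        have "compositum S U V \<subseteq> P.sat R"
          unfolding compositum_def
          using carr P.subset_sat[OF carr(2)] P.subset_sat[OF carr(3)] 2 P.sat_subalgebra[OF R_subalgebra]
          by (intro generate_ring_min_subring1) (auto simp: subalgebras_def)
        then show ?thesis using xUV by blast
      qed
      then show ?thesis using RW by blast
    qed
    then obtain u where u: "u \<in> P.N" "u \<otimes> x \<in> W" by (auto simp: P.sat_def)
    then have "u \<in> I" by (simp add: I_def)
    then show False using IP P.N_not_P[OF u(1)] by blast
  qed
  ultimately show "T \<inter> compositum S U V = compositum S (T \<inter> U) (T \<inter> V)"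
    unfolding W_def by blast
qed

end

theorem proposition4p4:
  fixes S :: "('a, 'b) ring_scheme" and R :: "'a set"
  assumes "cring S" and "subring R S" and "R \<noteq> carrier S"
    and "seminormal_extension S R"
    and "infra_integral_extension S R"
    and "FCP_extension S R"
  shows "distributive_extension S R \<longleftrightarrow> locally_minimal_extension S R"
proof
  interpret ring_extension S R
    using assms(1,2) by (simp add: ring_extension_def ring_extension_axioms_def)
  show "distributive_extension S R" if "locally_minimal_extension S R"
    using that by (rule locally_minimal_imp_distributive)
  show "locally_minimal_extension S R" if dist: "distributive_extension S R"
    unfolding locally_minimal_extension_def
  proof
    fix P assume P: "P \<in> ext_support S R"
    then have prime: "primeideal P (S\<lparr>carrier := R\<rparr>)"
      by (simp add: ext_support_def ring_spec_def)
    interpret P: ring_extension_prime S R P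
      by (intro ring_extension_prime.intro ring_extension_axioms ring_extension_prime_axioms.intro prime)
    show "minimal_extension (loc_ring S R P) (loc_subring S R P)"
      by (rule P.locally_simple_imp_minimal[OF P.distributive_imp_locally_simple[OF assms(4-6) dist] P])
  qed
qed

end
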